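(* Let $k$ be a field of characteristic different from $2$, let $G$ be a nonabelian torsion-free nilpotent group, and let $D$ be the (Ore) division ring of fractions of the group algebra $k[G]$. Let $\ast$ be a $k$-involution on $D$ which is induced by an involution of $G$. Then $D$ contains both a free symmetric pair and a free unitary pair with respect to $\ast$.
   Context: An involution on a group $G$ is an anti-automorphism of $G$ of order $2$. A $k$-involution on a $k$-algebra $R$ is a $k$-linear map $\ast$ with $(xy)^\ast=y^\ast x^\ast$ and $(x^\ast)^\ast=x$ for all $x,y\in R$. The $k$-linear extension of an involution of $G$ to $k[G]$ is a $k$-involution; a $k$-involution on a division ring $D$ generated by $k[G]$ is said to be induced by the involution of $G$ if it extends this $k$-involution of $k[G]$. (For $G$ torsion-free nilpotent, $k[G]$ is an Ore domain, so its division ring of fractions exists.) An element $x$ is symmetric if $x^\ast=x$ and unitary if $xx^\ast=x^\ast x=1$. Two elements $x,y$ form a free symmetric (resp. unitary) pair if both are symmetric (resp. unitary) and they generate a free noncyclic (i.e. free of rank $2$ on $x,y$) subgroup of the multiplicative group. *)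

theory Defs
  imports "HOL-Algebra.Algebra"
begin

definition commutator_grp :: "('g, 'b) monoid_scheme \<Rightarrow> 'g \<Rightarrow> 'g \<Rightarrow> 'g" where
  "commutator_grp G x y = x \<otimes>\<^bsub>G\<^esub> y \<otimes>\<^bsub>G\<^esub> inv\<^bsub>G\<^esub> x \<otimes>\<^bsub>G\<^esub> inv\<^bsub>G\<^esub> y"

fun lower_central :: "('g, 'b) monoid_scheme \<Rightarrow> nat \<Rightarrow> 'g set" where
  "lower_central G 0 = carrier G"
| "lower_central G (Suc n) =
     generate G {commutator_grp G x y | x y. x \<in> lower_central G n \<and> y \<in> carrier G}"

definition nilpotent_group :: "('g, 'b) monoid_scheme \<Rightarrow> bool" where
  "nilpotent_group G \<longleftrightarrow> group G \<and> (\<exists>n. lower_central G n = {\<one>\<^bsub>G\<^esub>})"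

definition torsion_free_group :: "('g, 'b) monoid_scheme \<Rightarrow> bool" where
  "torsion_free_group G \<longleftrightarrow>
     (\<forall>x\<in>carrier G. \<forall>n::nat. n > 0 \<longrightarrow> x [^]\<^bsub>G\<^esub> n = \<one>\<^bsub>G\<^esub> \<longrightarrow> x = \<one>\<^bsub>G\<^esub>)"

definition nonabelian_group :: "('g, 'b) monoid_scheme \<Rightarrow> bool" where
  "nonabelian_group G \<longleftrightarrow>
     (\<exists>x\<in>carrier G. \<exists>y\<in>carrier G. x \<otimes>\<^bsub>G\<^esub> y \<noteq> y \<otimes>\<^bsub>G\<^esub> x)"

text \<open>An involution of G: an anti-automorphism of order 2 (its square is the identity;
  it is not the identity since G is nonabelian).\<close>
definition group_involution :: "('g, 'b) monoid_scheme \<Rightarrow> ('g \<Rightarrow> 'g) \<Rightarrow> bool" where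
  "group_involution G \<sigma> \<longleftrightarrow>
     (\<forall>x\<in>carrier G. \<sigma> x \<in> carrier G) \<and>
     (\<forall>x\<in>carrier G. \<forall>y\<in>carrier G. \<sigma> (x \<otimes>\<^bsub>G\<^esub> y) = \<sigma> y \<otimes>\<^bsub>G\<^esub> \<sigma> x) \<and>
     (\<forall>x\<in>carrier G. \<sigma> (\<sigma> x) = x) \<and>
     (\<exists>x\<in>carrier G. \<sigma> x \<noteq> x)"

inductive_set div_subring_gen :: "'d::division_ring set \<Rightarrow> 'd set" for A where
  base: "a \<in> A \<Longrightarrow> a \<in> div_subring_gen A"
| zero: "0 \<in> div_subring_gen A"
| one: "1 \<in> div_subring_gen A"
| add: "a \<in> div_subring_gen A \<Longrightarrow> b \<in> div_subring_gen A \<Longrightarrow> a + b \<in> div_subring_gen A"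
| neg: "a \<in> div_subring_gen A \<Longrightarrow> - a \<in> div_subring_gen A"
| mult: "a \<in> div_subring_gen A \<Longrightarrow> b \<in> div_subring_gen A \<Longrightarrow> a * b \<in> div_subring_gen A"
| inv: "a \<in> div_subring_gen A \<Longrightarrow> inverse a \<in> div_subring_gen A"

text \<open>D is a k-algebra via the central embedding iota : k -> D; phi : G -> D is a
  multiplicative map whose k-linear extension k[G] -> D is injective, and D is generated
  by (the image of) k[G] as a division ring. Since k[G] is an Ore domain, this
  characterizes D up to isomorphism as the Ore division ring of fractions of k[G].\<close>
definition is_fraction_division_ring ::
  "('g, 'b) monoid_scheme \<Rightarrow> ('k::field \<Rightarrow> 'd::division_ring) \<Rightarrow> ('g \<Rightarrow> 'd) \<Rightarrow> bool" where
  "is_fraction_division_ring G \<iota> \<phi> \<longleftrightarrow>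
     (\<forall>a b. \<iota> (a + b) = \<iota> a + \<iota> b) \<and>
     (\<forall>a b. \<iota> (a * b) = \<iota> a * \<iota> b) \<and>
     \<iota> 1 = 1 \<and>
     (\<forall>a x. \<iota> a * x = x * \<iota> a) \<and>
     (\<forall>x\<in>carrier G. \<forall>y\<in>carrier G. \<phi> (x \<otimes>\<^bsub>G\<^esub> y) = \<phi> x * \<phi> y) \<and>
     \<phi> \<one>\<^bsub>G\<^esub> = 1 \<and>
     (\<forall>S c. finite S \<longrightarrow> S \<subseteq> carrier G \<longrightarrow>
        (\<Sum>g\<in>S. \<iota> (c g) * \<phi> g) = 0 \<longrightarrow> (\<forall>g\<in>S. c g = 0)) \<and>
     div_subring_gen (range \<iota> \<union> \<phi> ` carrier G) = UNIV"

definition k_involution :: "('k::field \<Rightarrow> 'd::division_ring) \<Rightarrow> ('d \<Rightarrow> 'd) \<Rightarrow> bool" where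
  "k_involution \<iota> st \<longleftrightarrow>
     (\<forall>x y. st (x + y) = st x + st y) \<and>
     (\<forall>a x. st (\<iota> a * x) = \<iota> a * st x) \<and>
     (\<forall>x y. st (x * y) = st y * st x) \<and>
     (\<forall>x. st (st x) = x)"

text \<open>st is induced by sigma: it extends the k-linear extension of sigma to k[G],
  i.e. (by k-linearity) it agrees with sigma on the image of G.\<close>
definition induced_by :: "('g, 'b) monoid_scheme \<Rightarrow> ('g \<Rightarrow> 'd) \<Rightarrow> ('g \<Rightarrow> 'g) \<Rightarrow> ('d \<Rightarrow> 'd) \<Rightarrow> bool" where
  "induced_by G \<phi> \<sigma> st \<longleftrightarrow> (\<forall>g\<in>carrier G. st (\<phi> g) = \<phi> (\<sigma> g))"

definition letter_val :: "'d::division_ring \<Rightarrow> 'd \<Rightarrow> bool \<times> bool \<Rightarrow> 'd" where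
  "letter_val x y l = (let z = (if fst l then x else y) in if snd l then z else inverse z)"

definition word_val :: "'d::division_ring \<Rightarrow> 'd \<Rightarrow> (bool \<times> bool) list \<Rightarrow> 'd" where
  "word_val x y w = prod_list (map (letter_val x y) w)"

definition reduced_word :: "(bool \<times> bool) list \<Rightarrow> bool" where
  "reduced_word w \<longleftrightarrow>
     (\<forall>i. Suc i < length w \<longrightarrow> \<not> (fst (w ! i) = fst (w ! Suc i) \<and> snd (w ! i) \<noteq> snd (w ! Suc i)))"

definition free_pair :: "'d::division_ring \<Rightarrow> 'd \<Rightarrow> bool" where
  "free_pair x y \<longleftrightarrow> x \<noteq> 0 \<and> y \<noteq> 0 \<and>
     (\<forall>w. w \<noteq> [] \<longrightarrow> reduced_word w \<longrightarrow> word_val x y w \<noteq> 1)"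

definition free_symmetric_pair :: "('d::division_ring \<Rightarrow> 'd) \<Rightarrow> 'd \<Rightarrow> 'd \<Rightarrow> bool" where
  "free_symmetric_pair st x y \<longleftrightarrow> st x = x \<and> st y = y \<and> free_pair x y"

definition unitary :: "('d::division_ring \<Rightarrow> 'd) \<Rightarrow> 'd \<Rightarrow> bool" where
  "unitary st x \<longleftrightarrow> x * st x = 1 \<and> st x * x = 1"

definition free_unitary_pair :: "('d::division_ring \<Rightarrow> 'd) \<Rightarrow> 'd \<Rightarrow> 'd \<Rightarrow> bool" where
  "free_unitary_pair st x y \<longleftrightarrow> unitary st x \<and> unitary st y \<and> free_pair x y"

end

theory Submission
  imports Defs "HOL-Computational_Algebra.Polynomial"
begin

text \<open>
  Composing the involution of \<open>G\<close> with inversion gives an automorphism \<open>\<tau>\<close> with \<open>\<tau>\<^sup>2 = 1\<close>. Pushing elements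
  down the lower central series one finds \<open>a\<close>, \<open>b\<close>, each fixed or inverted by \<open>\<tau>\<close>, whose commutator \<open>q \<noteq> 1\<close>
  commutes with both. In \<open>D\<close> this is a pair with \<open>A B = q B A\<close> and \<open>q\<close> transcendental over \<open>k\<close>.

  Specialise \<open>q\<close> to \<open>-1\<close>, \<open>A\<close> to \<open>X \<cdot> diag(1,-1)\<close> and \<open>B\<close> to \<open>X\<close> times the swap matrix, over \<open>k[X]\<close>. This extends to
  denominators from \<open>k[q,A]\<close> and \<open>k[q,B]\<close> with nonzero scalar image, which form an Ore set because \<open>A\<close> and
  \<open>B\<close> normalise these rings. Suitable rational functions of \<open>A\<close> and of \<open>B\<close> become, up to scalars and at
  \<open>X = 1\<close>, matrices \<open>1 \<plusminus> S\<close> with \<open>S\<close> one of the two reflections. These have rank one, and a product of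
  them along a reduced word is nonzero of rank one since the characteristic is not \<open>2\<close>; hence no such word is trivial.

  The symmetric pair consists of \<open>w w\<^sup>*\<close> for \<open>w = 1 + A\<close>, \<open>1 + B\<close>, the unitary pair of \<open>w (w\<^sup>*)\<^sup>-\<^sup>1\<close> for \<open>w = 1 + A'\<close>, \<open>1 + B'\<close>,
  where \<open>(A', B')\<close> is another \<open>q\<close>-commuting pair, adapted to the action of the involution on \<open>A\<close> and \<open>B\<close>.
\<close>

subsection \<open>Two-by-two matrices\<close>

datatype 'a m2 = M2 (m11: 'a) (m12: 'a) (m21: 'a) (m22: 'a)

instantiation m2 :: (comm_ring_1) ring_1
begin

definition "0 = M2 0 0 0 0"
definition "1 = M2 1 0 0 1"
definition "x + y = M2 (m11 x + m11 y) (m12 x + m12 y) (m21 x + m21 y) (m22 x + m22 y)"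
definition "x - y = M2 (m11 x - m11 y) (m12 x - m12 y) (m21 x - m21 y) (m22 x - m22 y)"
definition "- x = M2 (- m11 x) (- m12 x) (- m21 x) (- m22 x)"
definition "x * y = M2 (m11 x * m11 y + m12 x * m21 y) (m11 x * m12 y + m12 x * m22 y)
                       (m21 x * m11 y + m22 x * m21 y) (m21 x * m12 y + m22 x * m22 y)"

instance
  by standard
    (simp_all add: zero_m2_def one_m2_def plus_m2_def minus_m2_def uminus_m2_def times_m2_def
      algebra_simps)

end

lemmas m2_ops = zero_m2_def one_m2_def plus_m2_def minus_m2_def uminus_m2_def times_m2_def

definition scalar2 :: "'a::comm_ring_1 \<Rightarrow> 'a m2" where
  "scalar2 a = M2 a 0 0 a"

lemma scalar2_mult: "scalar2 (a * b) = scalar2 a * scalar2 b"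
  and scalar2_add: "scalar2 (a + b) = scalar2 a + scalar2 b"
  and scalar2_minus: "scalar2 (- a) = - scalar2 a"
  and scalar2_0: "scalar2 0 = 0"
  and scalar2_1: "scalar2 1 = 1"
  by (simp_all add: scalar2_def m2_ops)

lemma scalar2_eq_0_iff: "scalar2 a = 0 \<longleftrightarrow> a = 0"
  by (simp add: scalar2_def m2_ops)

lemma scalar2_commute: "scalar2 a * x = x * scalar2 a"
  by (simp add: scalar2_def m2_ops mult.commute)

lemma scalar2_mult_left_cancel:
  fixes a :: "'a::idom"
  assumes "a \<noteq> 0" "scalar2 a * x = scalar2 a * y"
  shows "x = y"
  using assms by (cases x; cases y) (simp add: scalar2_def m2_ops)

definition eval1_m2 :: "'a::comm_ring_1 poly m2 \<Rightarrow> 'a m2" where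
  "eval1_m2 x = M2 (poly (m11 x) 1) (poly (m12 x) 1) (poly (m21 x) 1) (poly (m22 x) 1)"

lemma eval1_m2_mult: "eval1_m2 (x * y) = eval1_m2 x * eval1_m2 y"
  and eval1_m2_scalar2: "eval1_m2 (scalar2 d) = scalar2 (poly d 1)"
  by (simp_all add: eval1_m2_def scalar2_def m2_ops)

text \<open>The indeterminate keeps \<open>1 + mat_A\<close> and its analogues invertible over the
  rational functions, since \<open>1 - mat_A * mat_A\<close> is the scalar \<open>1 - X^2\<close>;
  they drop to rank one only once X is set to 1.\<close>

definition mat_A :: "'a::comm_ring_1 poly m2" where "mat_A = M2 [:0, 1:] 0 0 [:0, -1:]"
definition mat_B :: "'a::comm_ring_1 poly m2" where "mat_B = M2 0 [:0, 1:] [:0, 1:] 0"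

lemma mat_A_mat_B: "mat_A * mat_B = - (mat_B * mat_A)" and mat_B_mat_A: "mat_B * mat_A = - (mat_A * mat_B)"
  by (simp_all add: mat_A_def mat_B_def m2_ops)

subsection \<open>Simultaneous polynomial expressions in a ring and in a matrix ring\<close>

text \<open>Pairs obtained by evaluating one and the same noncommutative polynomial in two rings.
  This is a relation because an element may be written in many ways; uniqueness of the matrix is
  proved later, for the generators used below. Left multiplication by a generator is the only
  product rule, so inductions move one letter at a time.\<close>

inductive spec_rel :: "('d::ring_1 \<times> 'm::ring_1) set \<Rightarrow> 'd \<Rightarrow> 'm \<Rightarrow> bool" for S where
  rel_zero: "spec_rel S 0 0"
| rel_one: "spec_rel S 1 1"
| rel_add: "spec_rel S x P \<Longrightarrow> spec_rel S y Q \<Longrightarrow> spec_rel S (x + y) (P + Q)"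
| rel_lmult: "(g, \<Gamma>) \<in> S \<Longrightarrow> spec_rel S x P \<Longrightarrow> spec_rel S (g * x) (\<Gamma> * P)"

lemma rel_mono:
  assumes "spec_rel S x P" "S \<subseteq> T"
  shows "spec_rel T x P"
  using assms by induction (auto intro: spec_rel.intros)

lemma rel_gen: "(g, \<Gamma>) \<in> S \<Longrightarrow> spec_rel S g \<Gamma>"
  using rel_lmult[OF _ rel_one, of g \<Gamma> S] by simp

lemma rel_mult:
  assumes "spec_rel S x P" "spec_rel S y Q"
  shows "spec_rel S (x * y) (P * Q)"
  using assms
  by (induction) (auto simp: distrib_right mult.assoc intro: spec_rel.intros)

lemma rel_commute:
  assumes "spec_rel S x P" "\<And>g \<Gamma>. (g, \<Gamma>) \<in> S \<Longrightarrow> z * g = g * z"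
  shows "z * x = x * z"
  using assms(1)
proof induction
  case (rel_lmult g \<Gamma> x P)
  then show ?case using assms(2) by (metis mult.assoc)
qed (simp_all add: algebra_simps)

lemma rel_commute_rel:
  assumes "spec_rel S x P" "spec_rel S y Q"
    and "\<And>g \<Gamma> h \<Delta>. (g, \<Gamma>) \<in> S \<Longrightarrow> (h, \<Delta>) \<in> S \<Longrightarrow> g * h = h * g"
  shows "x * y = y * x"
proof (rule rel_commute[OF assms(2)])
  fix g \<Gamma> assume "(g, \<Gamma>) \<in> S"
  then show "x * g = g * x"
    using rel_commute[OF assms(1), of g] assms(3) by metis
qed

section \<open>Polynomial normal forms\<close>

definition poly_rel ::
    "('d::ring_1 \<Rightarrow> 'm::ring_1 \<Rightarrow> bool) \<Rightarrow> 'd \<Rightarrow> 'm \<Rightarrow> 'd \<Rightarrow> 'm \<Rightarrow> bool" where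
  "poly_rel E t \<tau> x P \<longleftrightarrow>
     (\<exists>n e m. (\<forall>i. E (e i) (m i)) \<and> x = (\<Sum>i<n. t ^ i * e i) \<and> P = (\<Sum>i<n. \<tau> ^ i * m i))"

lemma sum_lessThan_pad:
  fixes f :: "nat \<Rightarrow> 'a::ring_1"
  assumes "n \<le> N"
  shows "(\<Sum>i<N. c ^ i * (if i < n then f i else 0)) = (\<Sum>i<n. c ^ i * f i)"
proof -
  have "(\<Sum>i<n. c ^ i * f i) = (\<Sum>i<n. c ^ i * (if i < n then f i else 0))"
    by (intro sum.cong) auto
  also have "\<dots> = (\<Sum>i<N. c ^ i * (if i < n then f i else 0))"
    using assms by (intro sum.mono_neutral_left) auto
  finally show ?thesis by simp
qed

lemma poly_rel_add:
  assumes E0: "E 0 0" and Eadd: "\<And>x P y Q. E x P \<Longrightarrow> E y Q \<Longrightarrow> E (x + y) (P + Q)"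
    and "poly_rel E t \<tau> x P" "poly_rel E t \<tau> y Q"
  shows "poly_rel E t \<tau> (x + y) (P + Q)"
proof -
  obtain n e m where 1: "\<forall>i. E (e i) (m i)" "x = (\<Sum>i<n. t ^ i * e i)" "P = (\<Sum>i<n. \<tau> ^ i * m i)"
    using assms(3) unfolding poly_rel_def by blast
  obtain n' e' m' where 2: "\<forall>i. E (e' i) (m' i)" "y = (\<Sum>i<n'. t ^ i * e' i)"
      "Q = (\<Sum>i<n'. \<tau> ^ i * m' i)"
    using assms(4) unfolding poly_rel_def by blast
  show ?thesis
    unfolding poly_rel_def
  proof (intro exI conjI)
    show "\<forall>i. E ((if i < n then e i else 0) + (if i < n' then e' i else 0))
                ((if i < n then m i else 0) + (if i < n' then m' i else 0))"
      using 1(1) 2(1) E0 by (intro allI Eadd) auto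
    show "x + y = (\<Sum>i<n+n'. t ^ i * ((if i < n then e i else 0) + (if i < n' then e' i else 0)))"
      unfolding distrib_left sum.distrib by (simp add: sum_lessThan_pad 1 2)
    show "P + Q = (\<Sum>i<n+n'. \<tau> ^ i * ((if i < n then m i else 0) + (if i < n' then m' i else 0)))"
      unfolding distrib_left sum.distrib by (simp add: sum_lessThan_pad 1 2)
  qed
qed

lemma poly_rel_base:
  assumes "E x P"
  shows "poly_rel E t \<tau> x P"
  unfolding poly_rel_def
  by (rule exI[of _ 1], rule exI[of _ "\<lambda>_. x"], rule exI[of _ "\<lambda>_. P"]) (simp add: assms)

lemma poly_rel_lmult_var:
  assumes "E 0 0" "poly_rel E t \<tau> x P"
  shows "poly_rel E t \<tau> (t * x) (\<tau> * P)"
proof -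
  obtain n e m where 1: "\<forall>i. E (e i) (m i)" "x = (\<Sum>i<n. t ^ i * e i)" "P = (\<Sum>i<n. \<tau> ^ i * m i)"
    using assms(2) unfolding poly_rel_def by blast
  show ?thesis
    unfolding poly_rel_def
  proof (intro exI conjI)
    show "\<forall>i. E (case i of 0 \<Rightarrow> 0 | Suc j \<Rightarrow> e j) (case i of 0 \<Rightarrow> 0 | Suc j \<Rightarrow> m j)"
      using 1(1) assms(1) by (auto split: nat.split)
    show "t * x = (\<Sum>i<Suc n. t ^ i * (case i of 0 \<Rightarrow> 0 | Suc j \<Rightarrow> e j))"
      unfolding sum.lessThan_Suc_shift by (simp add: 1 sum_distrib_left mult.assoc)
    show "\<tau> * P = (\<Sum>i<Suc n. \<tau> ^ i * (case i of 0 \<Rightarrow> 0 | Suc j \<Rightarrow> m j))"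
      unfolding sum.lessThan_Suc_shift by (simp add: 1 sum_distrib_left mult.assoc)
  qed
qed

text \<open>A multiplier that passes every power of the variable, changing only the coefficient,
  preserves the normal form. The new coefficient may depend on the exponent, which is how powers of
  \<open>q\<close> get absorbed.\<close>

lemma poly_rel_lmult_coeff:
  assumes g: "\<And>i e m. E e m \<Longrightarrow> \<exists>e' m'. E e' m' \<and> g * t ^ i * e = t ^ i * e' \<and> \<Gamma> * \<tau> ^ i * m = \<tau> ^ i * m'"
    and "poly_rel E t \<tau> x P"
  shows "poly_rel E t \<tau> (g * x) (\<Gamma> * P)"
proof -
  obtain n e m where 1: "\<forall>i. E (e i) (m i)" "x = (\<Sum>i<n. t ^ i * e i)" "P = (\<Sum>i<n. \<tau> ^ i * m i)"
    using assms(2) unfolding poly_rel_def by blast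
  have "\<forall>i. \<exists>e' m'. E e' m' \<and> g * t ^ i * e i = t ^ i * e' \<and> \<Gamma> * \<tau> ^ i * m i = \<tau> ^ i * m'"
    using g 1(1) by blast
  then obtain e' m' where 2: "\<And>i. E (e' i) (m' i) \<and> g * t ^ i * e i = t ^ i * e' i \<and> \<Gamma> * \<tau> ^ i * m i = \<tau> ^ i * m' i"
    by metis
  show ?thesis
    unfolding poly_rel_def
    by (rule exI[of _ n], rule exI[of _ e'], rule exI[of _ m'])
      (use 2 in \<open>simp add: 1 sum_distrib_left mult.assoc\<close>)
qed

text \<open>The summands are eigenvectors of conjugation by \<open>t\<close> with pairwise distinct eigenvalues.\<close>

lemma eigenvectors_independent:
  fixes q t :: "'d::division_ring"
  assumes q: "\<And>i j. q ^ i = q ^ j \<Longrightarrow> i = j" and t: "t \<noteq> 0" and qt: "q * t = t * q"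
    and "\<And>i. i < n \<Longrightarrow> f i * t = q ^ i * t * f i" and "\<And>i. i < n \<Longrightarrow> q * f i = f i * q"
    and "(\<Sum>i<n. f i) = 0" and "i < n"
  shows "f i = (0::'d)"
  using assms(4-)
proof (induction n arbitrary: f i)
  case (Suc n)
  have qit: "q ^ i * t = t * q ^ i" for i
    by (metis power_commuting_commutes qt)
  have qiq: "q ^ i * q ^ j = q ^ j * q ^ i" for i j
    by (metis power_add add.commute)
  have qqt: "q ^ i * (q ^ j * t) = (q ^ j * t) * q ^ i" for i j
    by (metis mult.assoc qit qiq)
  \<comment> \<open>Moving \<open>t\<close> to the left across the vanishing sum gives a second
    relation, in which the \<open>i\<close>-th summand has the weight \<open>q ^ i\<close>.\<close>
  have "0 = (\<Sum>i<Suc n. f i) * t"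
    using Suc.prems(3) by simp
  also have "\<dots> = (\<Sum>i<Suc n. q ^ i * t * f i)"
    unfolding sum_distrib_right using Suc.prems(1) by (intro sum.cong) auto
  also have "\<dots> = t * (\<Sum>i<Suc n. q ^ i * f i)"
    unfolding sum_distrib_left by (intro sum.cong refl) (simp only: qit mult.assoc)
  finally have 1: "(\<Sum>i<Suc n. q ^ i * f i) = 0"
    using t by simp
  \<comment> \<open>Subtracting \<open>q ^ n\<close> times the original relation removes the last
    summand; the remaining weights are nonzero because the powers of \<open>q\<close> are
    distinct.\<close>
  have "(\<Sum>i<n. (q ^ i - q ^ n) * f i) = (\<Sum>i<Suc n. (q ^ i - q ^ n) * f i)"
    by simp
  also have "\<dots> = (\<Sum>i<Suc n. q ^ i * f i) - q ^ n * (\<Sum>i<Suc n. f i)"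
    unfolding sum_distrib_left left_diff_distrib sum_subtractf by simp
  also have "\<dots> = 0"
    using 1 Suc.prems(3) by simp
  finally have 2: "(\<Sum>i<n. (q ^ i - q ^ n) * f i) = 0" .
  have 3: "f i = 0" if "i < n" for i
  proof -
    have "(q ^ i - q ^ n) * f i = 0"
    proof (rule Suc.IH[OF _ _ 2 that])
      fix j assume j: "j < n"
      have "(q ^ j - q ^ n) * f j * t = (q ^ j - q ^ n) * (q ^ j * t * f j)"
        using Suc.prems(1)[of j] j by (simp add: mult.assoc)
      also have "\<dots> = q ^ j * t * ((q ^ j - q ^ n) * f j)"
        using qqt[of j j] qqt[of n j] by (simp add: left_diff_distrib right_diff_distrib mult.assoc[symmetric])
      finally show "(q ^ j - q ^ n) * f j * t = q ^ j * t * ((q ^ j - q ^ n) * f j)" .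
      have "q * ((q ^ j - q ^ n) * f j) = (q ^ j - q ^ n) * (q * f j)"
        by (simp add: left_diff_distrib right_diff_distrib mult.assoc[symmetric] power_commutes)
      also have "\<dots> = (q ^ j - q ^ n) * f j * q"
        using Suc.prems(2)[of j] j by (simp add: mult.assoc)
      finally show "q * ((q ^ j - q ^ n) * f j) = (q ^ j - q ^ n) * f j * q" .
    qed
    then show ?thesis
      using q[of i n] that by auto
  qed
  moreover have "f n = 0"
    using Suc.prems(3) 3 by simp
  ultimately show ?case
    using Suc.prems(4) less_Suc_eq by auto
qed simp

subsection \<open>Specialising a \<open>q\<close>-commuting pair at \<open>q = -1\<close>\<close>

definition eval_at :: "('k::comm_ring_1 \<Rightarrow> 'd::ring_1) \<Rightarrow> 'd \<Rightarrow> 'k poly \<Rightarrow> 'd" where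
  "eval_at \<iota> q f = fold_coeffs (\<lambda>c x. \<iota> c + q * x) f 0"

lemma eval_at_pCons: "\<iota> 0 = 0 \<Longrightarrow> eval_at \<iota> q (pCons c f) = \<iota> c + q * eval_at \<iota> q f"
  by (cases "c = 0 \<and> f = 0") (auto simp: eval_at_def)

text \<open>\<open>q\<close> commutes with \<open>A\<close> and \<open>B\<close>, and
  \<open>trans\<close> says that it is transcendental over the base field, which is what allows it
  to be sent to -1.\<close>

locale q_pair =
  fixes \<iota> :: "'k::field \<Rightarrow> 'd::division_ring" and A B q :: 'd
  assumes iota_add: "\<iota> (a + b) = \<iota> a + \<iota> b"
    and iota_mult: "\<iota> (a * b) = \<iota> a * \<iota> b"
    and iota_one: "\<iota> 1 = 1"
    and iota_central: "\<iota> a * x = x * \<iota> a"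
    and A_nz: "A \<noteq> 0" and B_nz: "B \<noteq> 0" and q_nz: "q \<noteq> 0"
    and q_comm: "A * B = q * B * A"
    and q_A: "q * A = A * q" and q_B: "q * B = B * q"
    and trans: "eval_at \<iota> q f = 0 \<Longrightarrow> f = 0"
begin

lemma iota_zero: "\<iota> 0 = 0"
  using iota_add[of 0 0] by simp

lemma iota_minus_one: "\<iota> (- 1) = - 1"
  using iota_add[of 1 "-1"] iota_one iota_zero by (simp add: add_eq_0_iff)

lemma eval_at_0: "eval_at \<iota> q 0 = 0"
  by (simp add: eval_at_def)

lemmas eval_at_pCons_iota = eval_at_pCons[where \<iota> = \<iota>, OF iota_zero]

lemma eval_at_1: "eval_at \<iota> q 1 = 1"
  by (simp add: one_pCons eval_at_pCons_iota eval_at_0 iota_one)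

lemma eval_at_add: "eval_at \<iota> q (f + g) = eval_at \<iota> q f + eval_at \<iota> q g"
  by (induction f g rule: poly_induct2) (simp_all add: eval_at_0 eval_at_pCons_iota iota_add algebra_simps)

lemma eval_at_smult: "eval_at \<iota> q (smult c f) = \<iota> c * eval_at \<iota> q f"
proof (induction f)
  case (pCons a f)
  have "q * (\<iota> c * eval_at \<iota> q f) = \<iota> c * (q * eval_at \<iota> q f)"
    by (metis iota_central mult.assoc)
  with pCons show ?case by (simp add: eval_at_pCons_iota iota_mult distrib_left)
qed (simp add: eval_at_0)

lemma eval_at_shift: "eval_at \<iota> q ((pCons 0 ^^ n) f) = q ^ n * eval_at \<iota> q f"
  by (induction n) (simp_all add: eval_at_pCons_iota iota_zero mult.assoc)

lemma poly_shift: "poly ((pCons 0 ^^ n) f) x = x ^ n * poly f (x::'k)"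
  by (induction n) simp_all

lemma q_power_inj:
  assumes "q ^ i = q ^ j"
  shows "i = j"
proof -
  \<comment> \<open>Transcendence is applied to \<open>X^i - X^j\<close>; comparing degrees then
    gives \<open>i = j\<close>.\<close>
  have "eval_at \<iota> q ((pCons 0 ^^ i) 1 + smult (- 1) ((pCons 0 ^^ j) 1)) = 0"
    unfolding eval_at_add eval_at_smult eval_at_shift
    by (simp add: assms iota_minus_one eval_at_1)
  then have *: "(pCons 0 ^^ i) 1 = (pCons 0 ^^ j) (1::'k poly)"
    using trans by fastforce
  have "degree ((pCons 0 ^^ n) (1::'k poly)) = n \<and> (pCons 0 ^^ n) (1::'k poly) \<noteq> 0" for n
    by (induction n) auto
  then show ?thesis
    using * by metis
qed

lemma q_power_neq_1: "n > 0 \<Longrightarrow> q ^ n \<noteq> 1"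
  using q_power_inj[of n 0] by auto

section \<open>The coefficient ring k[q, 1/q] and its value at q = -1\<close>

definition gensC :: "('d \<times> 'k poly m2) set" where
  "gensC = range (\<lambda>c. (\<iota> c, scalar2 [:c:])) \<union> {(q, - 1), (inverse q, - 1)}"
definition "gensA = insert (A, mat_A) gensC"
definition "gensB = insert (B, mat_B) gensC"
definition "gens = insert (A, mat_A) (insert (B, mat_B) gensC)"

lemma q_inverse: "q * inverse q = 1" "inverse q * q = 1"
  using q_nz by auto

lemma commute_inverse: "q * x = x * q \<Longrightarrow> inverse q * x = x * inverse q"
  by (metis mult.assoc mult_1_left mult_1_right q_inverse)

lemma gensC_commute:
  assumes "(g, \<Gamma>) \<in> gensC" "q * x = x * q"
  shows "x * g = g * x"
  using assms commute_inverse[of x] unfolding gensC_def by (auto simp: iota_central)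

lemma relC_commute:
  assumes "spec_rel gensC x P" "q * y = y * q"
  shows "y * x = x * y"
  using rel_commute[OF assms(1)] gensC_commute assms(2) by metis

lemma gensC_matrix:
  assumes "(g, \<Gamma>) \<in> gensC" shows "\<exists>c. \<Gamma> = scalar2 c"
proof -
  have "- 1 = scalar2 (- 1 :: 'k poly)"
    by (simp add: scalar2_def m2_ops)
  with assms show ?thesis
    unfolding gensC_def by auto
qed

lemma gensC_matrix_commute:
  assumes "(g, \<Gamma>) \<in> gensC" shows "\<Gamma> * M = M * \<Gamma>"
  using gensC_matrix[OF assms] scalar2_commute by metis

text \<open>A factor \<open>q ^ N\<close>, whose image is the sign \<open>(- 1) ^ N\<close>, clears
  the negative powers of \<open>q\<close>. What remains is a polynomial in \<open>q\<close>, and its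
  image is the value of that polynomial at -1.\<close>

lemma relC_polynomial:
  assumes "spec_rel gensC x P"
  shows "\<exists>N f. q ^ N * x = eval_at \<iota> q f \<and> (- 1) ^ N * P = scalar2 [:poly f (- 1):]"
  using assms
proof induction
  case rel_zero
  show ?case by (rule exI[of _ 0], rule exI[of _ 0]) (simp add: eval_at_0 scalar2_0)
next
  case rel_one
  show ?case
    by (rule exI[of _ 0], rule exI[of _ 1])
      (simp add: eval_at_1 scalar2_1 one_pCons[symmetric])
next
  case (rel_add x P y Q)
  then obtain N f M g where
    1: "q ^ N * x = eval_at \<iota> q f" "(- 1) ^ N * P = scalar2 [:poly f (- 1):]"
    and 2: "q ^ M * y = eval_at \<iota> q g" "(- 1) ^ M * Q = scalar2 [:poly g (- 1):]"
    by blast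
  have sgn: "(- 1) ^ n * scalar2 [:c:] = scalar2 [:(- 1) ^ n * c :: 'k:]" for n c
    by (cases "even n") (simp_all add: scalar2_minus[symmetric])
  let ?h = "(pCons 0 ^^ M) f + (pCons 0 ^^ N) g"
  have "q ^ (N + M) * (x + y) = q ^ M * (q ^ N * x) + q ^ N * (q ^ M * y)"
    by (simp add: distrib_left mult.assoc[symmetric] power_add[symmetric] add.commute)
  also have "\<dots> = eval_at \<iota> q ?h"
    by (simp add: 1 2 eval_at_add eval_at_shift)
  finally have "q ^ (N + M) * (x + y) = eval_at \<iota> q ?h" .
  moreover have "(- 1) ^ (N + M) * (P + Q) = (- 1) ^ M * ((- 1) ^ N * P) + (- 1) ^ N * ((- 1) ^ M * Q)"
    by (simp add: distrib_left mult.assoc[symmetric] power_add[symmetric] add.commute)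
  then have "(- 1) ^ (N + M) * (P + Q) = scalar2 [:poly ?h (- 1):]"
    by (simp add: 1 2 sgn poly_shift scalar2_add[symmetric])
  ultimately show ?case by blast
next
  case (rel_lmult g \<Gamma> x P)
  then obtain N f where 1: "q ^ N * x = eval_at \<iota> q f" "(- 1) ^ N * P = scalar2 [:poly f (- 1):]"
    by blast
  consider c where "g = \<iota> c" "\<Gamma> = scalar2 [:c:]" | "g = q" "\<Gamma> = - 1" | "g = inverse q" "\<Gamma> = - 1"
    using rel_lmult.hyps unfolding gensC_def by auto
  then show ?case
  proof cases
    case cst: 1
    have "q ^ N * (g * x) = g * (q ^ N * x)"
      by (metis cst(1) iota_central mult.assoc)
    moreover have "(- 1) ^ N * (\<Gamma> * P) = \<Gamma> * ((- 1) ^ N * P)"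
      by (metis cst(2) scalar2_commute mult.assoc)
    ultimately show ?thesis
      by (intro exI[of _ N] exI[of _ "smult c f"])
        (simp add: 1 cst eval_at_smult scalar2_mult[symmetric] mult.commute)
  next
    case 2
    have "q ^ N * (g * x) = q * (q ^ N * x)"
      by (metis 2(1) power_commutes mult.assoc)
    moreover have "(- 1) ^ N * (\<Gamma> * P) = - ((- 1) ^ N * P)"
      using 2 by simp
    ultimately show ?thesis
      by (intro exI[of _ N] exI[of _ "pCons 0 f"])
        (simp add: 1 eval_at_pCons_iota iota_zero scalar2_minus[symmetric])
  next
    case 3
    have "q ^ Suc N * (g * x) = q ^ N * (q * inverse q) * x"
      by (simp only: 3 power_Suc2 mult.assoc)
    moreover have "(- 1) ^ Suc N * (\<Gamma> * P) = (- 1) ^ N * P"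
      by (simp add: 3)
    ultimately show ?thesis
      by (intro exI[of _ "Suc N"] exI[of _ f]) (simp add: 1 q_inverse del: power_Suc)
  qed
qed

text \<open>Transcendence of \<open>q\<close> forces the polynomial found above to be zero, hence
  also its value at -1.\<close>

lemma relC_functional:
  assumes "spec_rel gensC 0 P"
  shows "P = 0"
proof -
  obtain N f where 1: "q ^ N * 0 = eval_at \<iota> q f" "(- 1) ^ N * P = scalar2 [:poly f (- 1):]"
    using relC_polynomial[OF assms] by blast
  then have "f = 0"
    using trans by simp
  then have "(- 1) ^ N * P = 0"
    using 1 by (simp add: scalar2_0)
  then show ?thesis
    by (cases "even N") auto
qed

section \<open>Normal forms in A and B, and uniqueness of the specialised matrix\<close>

abbreviation "E1 \<equiv> poly_rel (spec_rel gensC) B mat_B"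
abbreviation "E2 \<equiv> poly_rel E1 A mat_A"

lemma A_pow_B: "A ^ i * B = q ^ i * B * A ^ i"
proof (induction i)
  case (Suc i)
  have "A ^ Suc i * B = A * (q ^ i * B * A ^ i)"
    using Suc by (simp add: mult.assoc)
  also have "\<dots> = q ^ i * (A * B) * A ^ i"
    by (metis mult.assoc power_commuting_commutes q_A)
  also have "\<dots> = (q ^ i * q) * B * (A * A ^ i)"
    by (simp add: q_comm mult.assoc)
  also have "\<dots> = q ^ Suc i * B * A ^ Suc i"
    by (simp add: power_commutes)
  finally show ?case .
qed simp

lemma q_comm': "B * A = inverse q * A * B"
  by (metis q_comm mult.assoc mult_1_left q_inverse(2))

lemma q_inv_A: "inverse q * A = A * inverse q"
  and q_inv_B: "inverse q * B = B * inverse q"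
  by (simp_all add: commute_inverse q_A q_B)


lemma B_pow_A: "B ^ i * A = inverse q ^ i * A * B ^ i"
proof (induction i)
  case (Suc i)
  have "B ^ Suc i * A = B * (inverse q ^ i * A * B ^ i)"
    using Suc by (simp add: mult.assoc)
  also have "\<dots> = inverse q ^ i * (B * A) * B ^ i"
    by (metis mult.assoc power_commuting_commutes q_inv_B)
  also have "\<dots> = (inverse q ^ i * inverse q) * A * (B * B ^ i)"
    by (simp add: q_comm' mult.assoc)
  also have "\<dots> = inverse q ^ Suc i * A * B ^ Suc i"
    by (simp add: power_commutes)
  finally show ?case .
qed simp

lemma B_A_pow: "B * A ^ i = A ^ i * (inverse q ^ i * B)"
proof (induction i)
  case (Suc i)
  have "B * A ^ Suc i = inverse q * (A * (B * A ^ i))"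
    by (simp add: q_comm' mult.assoc[symmetric])
  also have "\<dots> = inverse q * (A ^ Suc i * (inverse q ^ i * B))"
    by (simp add: Suc mult.assoc)
  also have "\<dots> = A ^ Suc i * (inverse q * (inverse q ^ i * B))"
    by (metis mult.assoc power_commuting_commutes q_inv_A)
  finally show ?case by (simp add: mult.assoc)
qed simp

lemma mat_B_mat_A_pow: "(mat_B :: 'k poly m2) * mat_A ^ i = mat_A ^ i * ((- 1) ^ i * mat_B)"
proof (induction i)
  case (Suc i)
  have "(mat_B :: 'k poly m2) * mat_A ^ Suc i = - (mat_A * (mat_B * mat_A ^ i))"
    by (simp add: mat_B_mat_A mult.assoc[symmetric])
  also have "\<dots> = - (mat_A ^ Suc i * ((- 1) ^ i * mat_B))"
    by (simp only: Suc power_Suc mult.assoc)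
  finally show ?case by simp
qed simp

lemma E1_add: "E1 x P \<Longrightarrow> E1 y Q \<Longrightarrow> E1 (x + y) (P + Q)"
  by (rule poly_rel_add) (auto intro: spec_rel.intros)

lemma E1_zero: "E1 0 0"
  by (rule poly_rel_base) (rule rel_zero)

lemma E1_lmult_C:
  assumes "(g, \<Gamma>) \<in> gensC" "E1 x P"
  shows "E1 (g * x) (\<Gamma> * P)"
proof (rule poly_rel_lmult_coeff[OF _ assms(2)])
  fix i e m assume "spec_rel gensC e m"
  then have "spec_rel gensC (g * e) (\<Gamma> * m)"
    using assms(1) by (rule rel_lmult[rotated])
  moreover have "q * B ^ i = B ^ i * q"
    by (metis power_commuting_commutes q_B)
  then have "g * B ^ i * e = B ^ i * (g * e)"
    using gensC_commute[OF assms(1), of "B ^ i"] by (simp add: mult.assoc[symmetric])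
  moreover have "\<Gamma> * mat_B ^ i * m = mat_B ^ i * (\<Gamma> * m)"
    by (simp only: gensC_matrix_commute[OF assms(1), of "mat_B ^ i"] mult.assoc)
  ultimately show "\<exists>e' m'. spec_rel gensC e' m' \<and> g * B ^ i * e = B ^ i * e' \<and> \<Gamma> * mat_B ^ i * m = mat_B ^ i * m'"
    by blast
qed

lemma E1_lmult_q_inv: "E1 x P \<Longrightarrow> E1 (inverse q ^ i * x) ((- 1) ^ i * P)"
proof (induction i)
  case (Suc i)
  then show ?case
    using E1_lmult_C[of "inverse q" "- 1" "inverse q ^ i * x" "(- 1) ^ i * P"]
    by (simp add: mult.assoc gensC_def)
qed simp

lemma E1_lmult_B: "E1 x P \<Longrightarrow> E1 (B * x) (mat_B * P)"
  by (rule poly_rel_lmult_var) (rule rel_zero)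

lemma E1_commute:
  assumes "E1 x P" "q * y = y * q" "B * y = y * B"
  shows "x * y = y * x"
proof -
  obtain n e m where 1: "\<forall>i. spec_rel gensC (e i) (m i)" "x = (\<Sum>i<n. B ^ i * e i)"
    using assms(1) unfolding poly_rel_def by blast
  have "B ^ i * e i * y = y * (B ^ i * e i)" for i
  proof -
    have "e i * y = y * e i"
      using relC_commute[of "e i" "m i" y] 1(1) assms(2) by simp
    moreover have "B ^ i * y = y * B ^ i"
      by (metis power_commuting_commutes assms(3))
    ultimately show ?thesis
      by (metis mult.assoc)
  qed
  then show ?thesis
    by (simp add: 1 sum_distrib_left sum_distrib_right)
qed

lemma inv_q_power_inj:
  assumes "inverse q ^ i = inverse q ^ j" shows "i = j"
  using assms q_power_inj[of i j] by (simp add: power_inverse)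

lemma q_pow_comm: "q * y = y * q \<Longrightarrow> q * y ^ i = y ^ i * q"
  by (metis power_commuting_commutes)

text \<open>The coefficients commute with \<open>A\<close>, so \<open>B ^ i * e i\<close> is an
  eigenvector of conjugation by \<open>A\<close> with eigenvalue \<open>inverse q ^ i\<close>. Such
  terms with zero sum all vanish, which reduces the claim to the coefficient ring.\<close>

lemma E1_functional:
  assumes "E1 0 P"
  shows "P = 0"
proof -
  obtain n e m where 1: "\<And>i. spec_rel gensC (e i) (m i)" "0 = (\<Sum>i<n. B ^ i * e i)"
      "P = (\<Sum>i<n. mat_B ^ i * m i)"
    using assms unfolding poly_rel_def by blast
  have "m i = 0" if "i < n" for i
  proof -
    have "B ^ i * e i = 0"
    proof (rule eigenvectors_independent[OF inv_q_power_inj A_nz q_inv_A _ _ _ that])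
      fix j
      have eA: "e j * A = A * e j" and eq: "e j * q = q * e j"
        using relC_commute[OF 1(1)[of j]] q_A by auto
      show "B ^ j * e j * A = inverse q ^ j * A * (B ^ j * e j)"
        by (metis B_pow_A eA mult.assoc)
      have "q * (B ^ j * e j) = B ^ j * e j * q"
        by (metis q_pow_comm[OF q_B] eq mult.assoc)
      then show "inverse q * (B ^ j * e j) = B ^ j * e j * inverse q"
        by (rule commute_inverse)
    qed (simp_all add: 1(2)[symmetric])
    then have "e i = 0"
      using B_nz by simp
    then show ?thesis
      using relC_functional[of "m i"] 1(1)[of i] by simp
  qed
  then show ?thesis
    by (simp add: 1(3))
qed

text \<open>The same argument one level up: the coefficients are now polynomials in
  \<open>B\<close>, so they commute with \<open>B\<close>, and conjugation by \<open>B\<close>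
  separates the powers of \<open>A\<close>.\<close>

lemma E2_functional:
  assumes "E2 0 P"
  shows "P = 0"
proof -
  obtain n e m where 1: "\<And>i. E1 (e i) (m i)" "0 = (\<Sum>i<n. A ^ i * e i)"
      "P = (\<Sum>i<n. mat_A ^ i * m i)"
    using assms unfolding poly_rel_def[of E1] by blast
  have "m i = 0" if "i < n" for i
  proof -
    have "A ^ i * e i = 0"
    proof (rule eigenvectors_independent[OF q_power_inj B_nz q_B _ _ _ that])
      fix j
      have eB: "e j * B = B * e j" and eq: "e j * q = q * e j"
        using E1_commute[OF 1(1)[of j]] q_B by auto
      show "A ^ j * e j * B = q ^ j * B * (A ^ j * e j)"
        by (metis A_pow_B eB mult.assoc)
      show "q * (A ^ j * e j) = A ^ j * e j * q"
        by (metis q_pow_comm[OF q_A] eq mult.assoc)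
    qed (simp_all add: 1(2)[symmetric])
    then have "e i = 0"
      using A_nz by simp
    then show ?thesis
      using E1_functional[of "m i"] 1(1)[of i] by simp
  qed
  then show ?thesis
    by (simp add: 1(3))
qed

text \<open>Expressions are sorted with powers of \<open>A\<close> on the left. Generators of the
  coefficient ring commute with \<open>A ^ i\<close>, and \<open>B\<close> passes it at the cost of
  \<open>inverse q ^ i\<close>, matched by \<open>(- 1) ^ i\<close> on the matrix side.\<close>

lemma rel_imp_E2:
  assumes "spec_rel gens x P"
  shows "E2 x P"
  using assms
proof induction
  case rel_zero
  show ?case by (intro poly_rel_base E1_zero)
next
  case rel_one
  show ?case by (intro poly_rel_base spec_rel.rel_one)
next
  case (rel_add x P y Q)
  then show ?case by (intro poly_rel_add E1_zero E1_add)
next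
  case (rel_lmult g \<Gamma> x P)
  consider "(g, \<Gamma>) \<in> gensC" | "g = A" "\<Gamma> = mat_A" | "g = B" "\<Gamma> = mat_B"
    using rel_lmult.hyps(1) unfolding gens_def by auto
  then show ?case
  proof cases
    case 1
    show ?thesis
    proof (rule poly_rel_lmult_coeff[OF _ rel_lmult.IH])
      fix i e m assume "E1 e m"
      then have "E1 (g * e) (\<Gamma> * m)"
        using 1 E1_lmult_C by blast
      moreover have "g * A ^ i * e = A ^ i * (g * e)"
        using gensC_commute[OF 1, of "A ^ i"] q_pow_comm[OF q_A] by (simp add: mult.assoc[symmetric])
      moreover have "\<Gamma> * mat_A ^ i * m = mat_A ^ i * (\<Gamma> * m)"
        by (simp only: gensC_matrix_commute[OF 1, of "mat_A ^ i"] mult.assoc)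
      ultimately show "\<exists>e' m'. E1 e' m' \<and> g * A ^ i * e = A ^ i * e' \<and> \<Gamma> * mat_A ^ i * m = mat_A ^ i * m'"
        by blast
    qed
  next
    case 2
    show ?thesis
      unfolding 2 by (intro poly_rel_lmult_var E1_zero rel_lmult.IH)
  next
    case 3
    show ?thesis
    proof (rule poly_rel_lmult_coeff[OF _ rel_lmult.IH])
      fix i e m assume "E1 e m"
      then have "E1 (inverse q ^ i * (B * e)) ((- 1) ^ i * (mat_B * m))"
        by (intro E1_lmult_q_inv E1_lmult_B)
      moreover have "g * A ^ i * e = A ^ i * (inverse q ^ i * (B * e))"
        by (simp add: 3 B_A_pow mult.assoc)
      moreover have "\<Gamma> * mat_A ^ i * m = mat_A ^ i * ((- 1) ^ i * (mat_B * m))"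
        by (simp only: 3 mat_B_mat_A_pow mult.assoc)
      ultimately show "\<exists>e' m'. E1 e' m' \<and> g * A ^ i * e = A ^ i * e' \<and> \<Gamma> * mat_A ^ i * m = mat_A ^ i * m'"
        by blast
    qed
  qed
qed

lemma rel_functional: "spec_rel gens 0 P \<Longrightarrow> P = 0"
  by (intro E2_functional rel_imp_E2)

lemma relC_const: "spec_rel gensC (\<iota> c) (scalar2 [:c:])"
  by (rule rel_gen) (simp add: gensC_def)

lemma rel_minus:
  assumes "gensC \<subseteq> S" "spec_rel S x P"
  shows "spec_rel S (- x) (- P)"
proof -
  have "spec_rel S (\<iota> (- 1)) (scalar2 [:- 1:])"
    using relC_const assms(1) by (rule rel_mono)
  from rel_mult[OF this assms(2)]
  have "spec_rel S (- x) (scalar2 [:- 1:] * P)"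
    by (simp add: iota_minus_one)
  moreover have "scalar2 [:- 1:] * P = - P"
    by (simp add: scalar2_def m2_ops)
  ultimately show ?thesis by simp
qed

lemma rel_diff:
  assumes "gensC \<subseteq> S" "spec_rel S x P" "spec_rel S y Q"
  shows "spec_rel S (x - y) (P - Q)"
  using rel_add[OF assms(2) rel_minus[OF assms(1,3)]] by simp

lemma rel_functional': "spec_rel gens x P \<Longrightarrow> spec_rel gens x Q \<Longrightarrow> P = Q"
  using rel_functional[of "P - Q"] rel_diff[of gens x P x Q] by (force simp: gens_def)

end

section \<open>The Ore condition\<close>

lemma rel_twist:
  assumes gen: "\<And>g \<Gamma>. (g, \<Gamma>) \<in> S \<Longrightarrow> \<exists>g' \<Gamma>'. spec_rel S g' \<Gamma>' \<and> g * t = t * g' \<and> \<Gamma> * \<tau> = \<tau> * \<Gamma>'"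
    and "spec_rel S s P"
  shows "\<exists>s' P'. spec_rel S s' P' \<and> s * t = t * s' \<and> P * \<tau> = \<tau> * P'"
  using assms(2)
proof induction
  case rel_zero
  show ?case using spec_rel.rel_zero by force
next
  case rel_one
  show ?case using spec_rel.rel_one by force
next
  case (rel_add x P y Q)
  then show ?case by (metis spec_rel.rel_add distrib_left distrib_right)
next
  case (rel_lmult g \<Gamma> x P)
  then obtain x' P' where x': "spec_rel S x' P'" "x * t = t * x'" "P * \<tau> = \<tau> * P'"
    by blast
  obtain g' \<Gamma>' where g': "spec_rel S g' \<Gamma>'" "g * t = t * g'" "\<Gamma> * \<tau> = \<tau> * \<Gamma>'"
    using gen[OF rel_lmult.hyps(1)] by blast
  have "g * x * t = t * (g' * x')" "\<Gamma> * P * \<tau> = \<tau> * (\<Gamma>' * P')"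
    using x' g' by (metis mult.assoc)+
  then show ?case
    using rel_mult[OF g'(1) x'(1)] by blast
qed

lemma mat_A_sq: "mat_A * mat_A = scalar2 [:0, 0, 1:]"
  and mat_B_sq: "mat_B * mat_B = scalar2 [:0, 0, 1:]"
  by (simp_all add: mat_A_def mat_B_def scalar2_def m2_ops)

text \<open>As \<open>\<tau>\<close> squares to a nonzero scalar, it can be cancelled. Hence moving
  a denominator past \<open>A\<close> or \<open>B\<close> leaves its scalar image unchanged.\<close>

lemma scalar2_commuting_unique:
  fixes e r :: "'a::idom"
  assumes "scalar2 e * \<tau> = \<tau> * P" "\<tau> * \<tau> = scalar2 r" "r \<noteq> 0"
  shows "P = scalar2 e"
proof -
  have "scalar2 r * P = \<tau> * (\<tau> * P)"
    by (simp add: assms(2)[symmetric] mult.assoc)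
  also have "\<dots> = \<tau> * \<tau> * scalar2 e"
    by (simp only: assms(1)[symmetric] scalar2_commute mult.assoc)
  finally show ?thesis
    using scalar2_mult_left_cancel[OF assms(3)] assms(2) by metis
qed

context q_pair
begin

lemma gensC_subset: "gensC \<subseteq> gensA" "gensC \<subseteq> gensB" "gensC \<subseteq> gens" "gensA \<subseteq> gens" "gensB \<subseteq> gens"
  by (auto simp: gensA_def gensB_def gens_def)

lemma gensA_commute:
  assumes "(g, \<Gamma>) \<in> gensA" "(h, \<Delta>) \<in> gensA"
  shows "g * h = h * g"
proof -
  have "q * g = g * q" if "(g, \<Gamma>) \<in> gensA" for g \<Gamma>
    using that gensC_commute[of g \<Gamma> q] q_A unfolding gensA_def by auto
  then show ?thesis
    using assms gensC_commute unfolding gensA_def by (smt (verit) insert_iff prod.inject)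
qed

lemma gensB_commute:
  assumes "(g, \<Gamma>) \<in> gensB" "(h, \<Delta>) \<in> gensB"
  shows "g * h = h * g"
proof -
  have "q * g = g * q" if "(g, \<Gamma>) \<in> gensB" for g \<Gamma>
    using that gensC_commute[of g \<Gamma> q] q_B unfolding gensB_def by auto
  then show ?thesis
    using assms gensC_commute unfolding gensB_def by (smt (verit) insert_iff prod.inject)
qed

text \<open>\<open>B\<close> normalises the ring generated by \<open>A\<close> over the
  coefficients, since \<open>A * B = B * (q * A)\<close>, and \<open>mat_B\<close> does the same for
  the images.\<close>

lemma relA_twist:
  assumes "spec_rel gensA s (scalar2 e)"
  shows "\<exists>s'. spec_rel gensA s' (scalar2 e) \<and> s * B = B * s'"
proof -
  have "\<exists>s' P'. spec_rel gensA s' P' \<and> s * B = B * s' \<and> scalar2 e * mat_B = mat_B * P'"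
  proof (rule rel_twist[OF _ assms])
    fix g \<Gamma> assume g: "(g, \<Gamma>) \<in> gensA"
    show "\<exists>g' \<Gamma>'. spec_rel gensA g' \<Gamma>' \<and> g * B = B * g' \<and> \<Gamma> * mat_B = mat_B * \<Gamma>'"
    proof (cases "(g, \<Gamma>) \<in> gensC")
      case True
      then show ?thesis
        using rel_gen[OF g] gensC_commute[OF True q_B] gensC_matrix_commute[OF True] by metis
    next
      case False
      then have gA: "g = A" "\<Gamma> = mat_A"
        using g unfolding gensA_def by auto
      have "spec_rel gensA (q * A) (- 1 * mat_A)"
        by (intro rel_mult rel_gen) (auto simp: gensA_def gensC_def)
      moreover have "A * B = B * (q * A)"
        by (metis q_comm q_B mult.assoc)
      ultimately show ?thesis
        using mat_A_mat_B unfolding gA by fastforce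
    qed
  qed
  then obtain s' P' where s': "spec_rel gensA s' P'" "s * B = B * s'" "scalar2 e * mat_B = mat_B * P'"
    by blast
  then have "P' = scalar2 e"
    using scalar2_commuting_unique[OF s'(3) mat_B_sq] by simp
  with s' show ?thesis by blast
qed

lemma relB_twist:
  assumes "spec_rel gensB s (scalar2 e)"
  shows "\<exists>s'. spec_rel gensB s' (scalar2 e) \<and> s * A = A * s'"
proof -
  have "\<exists>s' P'. spec_rel gensB s' P' \<and> s * A = A * s' \<and> scalar2 e * mat_A = mat_A * P'"
  proof (rule rel_twist[OF _ assms])
    fix g \<Gamma> assume g: "(g, \<Gamma>) \<in> gensB"
    show "\<exists>g' \<Gamma>'. spec_rel gensB g' \<Gamma>' \<and> g * A = A * g' \<and> \<Gamma> * mat_A = mat_A * \<Gamma>'"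
    proof (cases "(g, \<Gamma>) \<in> gensC")
      case True
      then show ?thesis
        using rel_gen[OF g] gensC_commute[OF True q_A] gensC_matrix_commute[OF True] by metis
    next
      case False
      then have gB: "g = B" "\<Gamma> = mat_B"
        using g unfolding gensB_def by auto
      have "spec_rel gensB (inverse q * B) (- 1 * mat_B)"
        by (intro rel_mult rel_gen) (auto simp: gensB_def gensC_def)
      moreover have "B * A = A * (inverse q * B)"
        by (metis q_comm' q_inv_A mult.assoc)
      ultimately show ?thesis
        using mat_B_mat_A unfolding gB by fastforce
    qed
  qed
  then obtain s' P' where s': "spec_rel gensB s' P'" "s * A = A * s'" "scalar2 e * mat_A = mat_A * P'"
    by blast
  then have "P' = scalar2 e"
    using scalar2_commuting_unique[OF s'(3) mat_A_sq] by simp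
  with s' show ?thesis by blast
qed

text \<open>Induction on \<open>p\<close> as a polynomial in the generators. A left factor
  \<open>g\<close> is passed by the twist; for a sum, the denominators of the two summands commute,
  so their product serves both.\<close>

lemma ore_generators:
  assumes comm: "\<And>g \<Gamma> h \<Delta>. (g, \<Gamma>) \<in> S \<Longrightarrow> (h, \<Delta>) \<in> S \<Longrightarrow> g * h = h * g"
    and "S \<subseteq> gens"
    and gen: "\<And>g \<Gamma> s e. (g, \<Gamma>) \<in> gens \<Longrightarrow> spec_rel S s (scalar2 e) \<Longrightarrow>
      \<exists>s'. spec_rel S s' (scalar2 e) \<and> s * g = g * s'"
    and "spec_rel gens p P" "spec_rel S s (scalar2 e)" "e \<noteq> 0"
  shows "\<exists>p' P' s' e'. spec_rel gens p' P' \<and> spec_rel S s' (scalar2 e') \<and> e' \<noteq> 0 \<and> s * p' = p * s'"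
  using assms(4-)
proof (induction arbitrary: s e)
  case rel_zero
  then show ?case using spec_rel.rel_zero by (metis mult_zero_left mult_zero_right)
next
  case rel_one
  then show ?case using spec_rel.rel_one by (metis mult_1_left mult_1_right)
next
  case (rel_add x P y Q)
  obtain x' P' s1 e1 where 1: "spec_rel gens x' P'" "spec_rel S s1 (scalar2 e1)" "e1 \<noteq> 0" "s * x' = x * s1"
    using rel_add.IH(1)[OF rel_add.prems] by blast
  obtain y' Q' s2 e2 where 2: "spec_rel gens y' Q'" "spec_rel S s2 (scalar2 e2)" "e2 \<noteq> 0" "s * y' = y * s2"
    using rel_add.IH(2)[OF rel_add.prems] by blast
  have "spec_rel gens (x' * s2 + y' * s1) (P' * scalar2 e2 + Q' * scalar2 e1)"
    using 1 2 rel_mono[OF _ assms(2)] by (intro spec_rel.rel_add rel_mult) auto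
  moreover have "spec_rel S (s1 * s2) (scalar2 (e1 * e2))"
    unfolding scalar2_mult using 1 2 by (intro rel_mult)
  moreover have "s1 * s2 = s2 * s1"
    using rel_commute_rel[OF 1(2) 2(2) comm] .
  then have "y * s2 * s1 = y * s1 * s2"
    by (simp add: mult.assoc)
  then have "s * (x' * s2 + y' * s1) = (x + y) * (s1 * s2)"
    by (simp add: distrib_left distrib_right mult.assoc[symmetric] 1(4) 2(4))
  ultimately show ?case
    using 1(3) 2(3) mult_eq_0_iff by blast
next
  case (rel_lmult g \<Gamma> x P)
  obtain s1 where s1: "spec_rel S s1 (scalar2 e)" "s * g = g * s1"
    using gen[OF rel_lmult.hyps(1) rel_lmult.prems(1)] by blast
  obtain x' P' s2 e2 where 2: "spec_rel gens x' P'" "spec_rel S s2 (scalar2 e2)" "e2 \<noteq> 0" "s1 * x' = x * s2"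
    using rel_lmult.IH[OF s1(1) rel_lmult.prems(2)] by blast
  have "spec_rel gens (g * x') (\<Gamma> * P')"
    using rel_lmult.hyps(1) 2(1) by (rule spec_rel.rel_lmult)
  moreover have "s * (g * x') = g * x * s2"
    by (metis s1(2) 2(4) mult.assoc)
  ultimately show ?case
    using 2 by blast
qed

section \<open>Denominators and the specialisation of fractions\<close>

inductive denom :: "'d \<Rightarrow> 'k poly \<Rightarrow> bool" where
  denomA: "spec_rel gensA s (scalar2 e) \<Longrightarrow> e \<noteq> 0 \<Longrightarrow> denom s e"
| denomB: "spec_rel gensB s (scalar2 e) \<Longrightarrow> e \<noteq> 0 \<Longrightarrow> denom s e"
| denom_mult: "denom s e \<Longrightarrow> denom t f \<Longrightarrow> denom (s * t) (e * f)"

lemma denom_rel: "denom s e \<Longrightarrow> spec_rel gens s (scalar2 e) \<and> e \<noteq> 0"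
  by (induction rule: denom.induct)
    (auto intro: rel_mono[OF _ gensC_subset(4)] rel_mono[OF _ gensC_subset(5)] rel_mult
      simp: scalar2_mult)

lemma rel_nonzero: "spec_rel gens x P \<Longrightarrow> P \<noteq> 0 \<Longrightarrow> x \<noteq> 0"
  using rel_functional by blast

lemma denom_nonzero: "denom s e \<Longrightarrow> s \<noteq> 0"
  using denom_rel rel_nonzero scalar2_eq_0_iff by metis

text \<open>The condition for each of the two commutative rings is chained along a product:
  \<open>p\<close> is moved past \<open>s\<close> first, and the resulting \<open>p1\<close> past
  \<open>t\<close>.\<close>

lemma ore:
  assumes "denom s e" "spec_rel gens p P"
  shows "\<exists>p' P' s' e'. spec_rel gens p' P' \<and> denom s' e' \<and> s * p' = p * s'"
  using assms
proof (induction arbitrary: p P rule: denom.induct)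
  case (denomA s e)
  have "\<exists>s'. spec_rel gensA s' (scalar2 e) \<and> s * g = g * s'"
    if "(g, \<Gamma>) \<in> gens" "spec_rel gensA s (scalar2 e)" for g \<Gamma> s e
  proof (cases "g = B")
    case False
    then have "(g, \<Gamma>) \<in> gensA"
      using that(1) unfolding gens_def gensA_def by auto
    then have "s * g = g * s"
      using rel_commute[OF that(2), of g] gensA_commute by metis
    then show ?thesis using that(2) by blast
  qed (use relA_twist[OF that(2)] in simp)
  then have "\<exists>p' P' s' e'. spec_rel gens p' P' \<and> spec_rel gensA s' (scalar2 e') \<and> e' \<noteq> 0 \<and> s * p' = p * s'"
    using denomA gensC_subset(4) gensA_commute by (intro ore_generators) blast+
  then show ?case using denom.denomA by blast
next
  case (denomB s e)
  have "\<exists>s'. spec_rel gensB s' (scalar2 e) \<and> s * g = g * s'"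
    if "(g, \<Gamma>) \<in> gens" "spec_rel gensB s (scalar2 e)" for g \<Gamma> s e
  proof (cases "g = A")
    case False
    then have "(g, \<Gamma>) \<in> gensB"
      using that(1) unfolding gens_def gensB_def by auto
    then have "s * g = g * s"
      using rel_commute[OF that(2), of g] gensB_commute by metis
    then show ?thesis using that(2) by blast
  qed (use relB_twist[OF that(2)] in simp)
  then have "\<exists>p' P' s' e'. spec_rel gens p' P' \<and> spec_rel gensB s' (scalar2 e') \<and> e' \<noteq> 0 \<and> s * p' = p * s'"
    using denomB gensC_subset(5) gensB_commute by (intro ore_generators) blast+
  then show ?case using denom.denomB by blast
next
  case (denom_mult s e t f)
  obtain p1 P1 s1 e1 where 1: "spec_rel gens p1 P1" "denom s1 e1" "s * p1 = p * s1"
    using denom_mult.IH(1)[OF denom_mult.prems] by blast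
  obtain p2 P2 t2 e2 where 2: "spec_rel gens p2 P2" "denom t2 e2" "t * p2 = p1 * t2"
    using denom_mult.IH(2)[OF 1(1)] by blast
  have "s * t * p2 = p * (s1 * t2)"
    by (metis 1(3) 2(3) mult.assoc)
  then show ?case
    using 1 2 denom.denom_mult by blast
qed

text \<open>The image of the fraction \<open>x\<close> is \<open>Y / d\<close> over the rational
  functions. The last equation is \<open>P / e = Y / d\<close> with denominators cleared, so only
  polynomial matrices occur.\<close>

definition specialises :: "'d \<Rightarrow> 'k poly m2 \<Rightarrow> 'k poly \<Rightarrow> bool" where
  "specialises x Y d \<longleftrightarrow> d \<noteq> 0 \<and> (\<exists>p P s e. spec_rel gens p P \<and> denom s e \<and> x = p * inverse s \<and>
     P * scalar2 d = Y * scalar2 e)"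

lemma specialises_quotient:
  assumes "spec_rel gens p P" "denom s e"
  shows "specialises (p * inverse s) P e"
  using assms denom_rel[OF assms(2)] unfolding specialises_def by blast

lemma specialises_mult:
  assumes "specialises x Y d" "specialises x' Y' d'"
  shows "specialises (x * x') (Y * Y') (d * d')"
proof -
  obtain p P s e where 1: "d \<noteq> 0" "spec_rel gens p P" "denom s e" "x = p * inverse s"
      "P * scalar2 d = Y * scalar2 e"
    using assms(1) unfolding specialises_def by blast
  obtain p' P' s' e' where 2: "d' \<noteq> 0" "spec_rel gens p' P'" "denom s' e'" "x' = p' * inverse s'"
      "P' * scalar2 d' = Y' * scalar2 e'"
    using assms(2) unfolding specialises_def by blast
  obtain r R t f where 3: "spec_rel gens r R" "denom t f" "s * r = p' * t"
    using ore[OF 1(3) 2(2)] by blast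
  have nz: "s \<noteq> 0" "s' \<noteq> 0" "t \<noteq> 0"
    using 1 2 3 denom_nonzero by auto
  \<comment> \<open>The Ore condition turns the inner left fraction into a right fraction, so the
    product becomes a single fraction.\<close>
  have "inverse s * p' = r * inverse t"
  proof -
    have "inverse s * p' = inverse s * (p' * t) * inverse t"
      using nz by (simp add: mult.assoc)
    also have "\<dots> = r * inverse t"
      using nz by (simp add: 3(3)[symmetric] mult.assoc[symmetric])
    finally show ?thesis .
  qed
  then have "x * x' = p * r * (inverse t * inverse s')"
    by (metis 1(4) 2(4) mult.assoc)
  then have xx: "x * x' = p * r * inverse (s' * t)"
    using nz by (simp add: nonzero_inverse_mult_distrib)
  have e: "e \<noteq> 0"
    using denom_rel[OF 1(3)] by simp
  \<comment> \<open>Both matrices belong to the element \<open>s * r = p' * t\<close>, so uniqueness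
    of the specialised matrix identifies them.\<close>
  have "scalar2 e * R = P' * scalar2 f"
  proof (rule rel_functional')
    show "spec_rel gens (s * r) (scalar2 e * R)"
      using denom_rel[OF 1(3)] 3(1) by (intro rel_mult) auto
    show "spec_rel gens (s * r) (P' * scalar2 f)"
      unfolding 3(3) using denom_rel[OF 3(2)] 2(2) by (intro rel_mult) auto
  qed
  then have eR: "P * (scalar2 e * R) = P * (P' * scalar2 f)"
    by simp
  have "scalar2 e * (P * R * scalar2 (d * d')) = P * (scalar2 e * R) * scalar2 (d * d')"
    by (simp add: scalar2_def m2_ops algebra_simps)
  also have "\<dots> = (P * scalar2 d) * (P' * scalar2 d') * scalar2 f"
    unfolding eR by (simp add: scalar2_def m2_ops algebra_simps)
  also have "\<dots> = scalar2 e * (Y * Y' * scalar2 (e' * f))"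
    unfolding 1(5) 2(5) by (simp add: scalar2_def m2_ops algebra_simps)
  finally have "P * R * scalar2 (d * d') = Y * Y' * scalar2 (e' * f)"
    by (rule scalar2_mult_left_cancel[OF e])
  then show ?thesis
    unfolding specialises_def
    using 1(1) 2(1) rel_mult[OF 1(2) 3(1)] denom_mult[OF 2(3) 3(2)] xx by (metis mult_eq_0_iff)
qed

lemma specialises_one_scalar:
  assumes "specialises 1 Y d"
  shows "Y = scalar2 d"
proof -
  obtain p P s e where 1: "spec_rel gens p P" "denom s e" "1 = p * inverse s"
      "P * scalar2 d = Y * scalar2 e"
    using assms unfolding specialises_def by blast
  have "p = s"
    using 1(3) denom_nonzero[OF 1(2)] by (metis left_inverse mult.assoc mult_1_left mult_1_right)
  then have "P = scalar2 e"
    using rel_functional'[OF 1(1)] denom_rel[OF 1(2)] by blast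
  then have "scalar2 e * scalar2 d = scalar2 e * Y"
    using 1(4) scalar2_commute by metis
  then show ?thesis
    using scalar2_mult_left_cancel denom_rel[OF 1(2)] by metis
qed

end

subsection \<open>Free pairs from a \<open>q\<close>-commuting pair\<close>

text \<open>Eigenvectors, for the eigenvalues 1 and -1, of the reflections at X = 1: of diag(1, -1)
  for the first letter and its inverse, of the swap for the second letter and its inverse.\<close>

fun lvec :: "bool \<times> bool \<Rightarrow> 'a::comm_ring_1 \<times> 'a" where
  "lvec (True, True) = (1, 0)"
| "lvec (True, False) = (0, 1)"
| "lvec (False, True) = (1, 1)"
| "lvec (False, False) = (1, - 1)"

definition outer :: "'a::comm_ring_1 \<times> 'a \<Rightarrow> 'a \<times> 'a \<Rightarrow> 'a m2" where
  "outer u v = M2 (fst u * fst v) (fst u * snd v) (snd u * fst v) (snd u * snd v)"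

text \<open>The dot product of the two vectors comes out as a factor. In characteristic not 2 it is
  zero only for a letter next to its own inverse.\<close>

lemma lvec_product_nonzero:
  fixes r :: "'a::field \<times> 'a"
  assumes "(2::'a) \<noteq> 0" "\<kappa> \<noteq> 0" "r \<noteq> (0, 0)" and "\<not> (fst l = fst l' \<and> snd l \<noteq> snd l')"
  shows "\<exists>r'. r' \<noteq> (0, 0) \<and> scalar2 \<kappa> * outer (lvec l) (lvec l) * outer (lvec l') r = outer (lvec l) r'"
proof -
  define c :: 'a where "c = \<kappa> * (fst (lvec l) * fst (lvec l') + snd (lvec l) * snd (lvec l'))"
  have "c \<noteq> 0"
    unfolding c_def using assms by (cases l rule: lvec.cases; cases l' rule: lvec.cases) auto
  then have "(c * fst r, c * snd r) \<noteq> (0, 0)"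
    using assms(3) by (cases r) auto
  moreover have "scalar2 \<kappa> * outer (lvec l) (lvec l) * outer (lvec l') r = outer (lvec l) (c * fst r, c * snd r)"
    by (simp add: c_def outer_def scalar2_def m2_ops algebra_simps)
  ultimately show ?thesis by blast
qed

text \<open>A nonzero outer product has rank one, whereas a scalar matrix has rank zero or
  two.\<close>

lemma outer_lvec_not_scalar:
  fixes r :: "'a::field \<times> 'a"
  assumes "r \<noteq> (0, 0)"
  shows "outer (lvec l) r \<noteq> scalar2 d"
  using assms by (cases r; cases l rule: lvec.cases) (auto simp: outer_def scalar2_def)

lemma reduced_word_Cons:
  assumes "reduced_word (l # l' # w)"
  shows "reduced_word (l' # w)" "\<not> (fst l = fst l' \<and> snd l \<noteq> snd l')"
proof -
  show "reduced_word (l' # w)"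
    unfolding reduced_word_def
  proof (intro allI impI)
    fix i assume "Suc i < length (l' # w)"
    then show "\<not> (fst ((l' # w) ! i) = fst ((l' # w) ! Suc i) \<and> snd ((l' # w) ! i) \<noteq> snd ((l' # w) ! Suc i))"
      using assms[unfolded reduced_word_def, rule_format, of "Suc i"] by simp
  qed
  show "\<not> (fst l = fst l' \<and> snd l \<noteq> snd l')"
    using assms[unfolded reduced_word_def, rule_format, of 0] by simp
qed

context q_pair
begin

text \<open>Only the numerator \<open>Y\<close> is evaluated at X = 1, where \<open>d\<close> may
  vanish; so an invertible \<open>z\<close> can acquire a singular matrix.\<close>

definition good_letter :: "bool \<times> bool \<Rightarrow> 'd \<Rightarrow> bool" where
  "good_letter l z \<longleftrightarrow> (\<exists>Y d \<kappa>. \<kappa> \<noteq> 0 \<and> specialises z Y d \<and>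
     eval1_m2 Y = scalar2 \<kappa> * outer (lvec l) (lvec l))"

definition good :: "bool \<Rightarrow> 'd \<Rightarrow> bool" where
  "good b x \<longleftrightarrow> good_letter (b, True) x \<and> good_letter (b, False) (inverse x)"

text \<open>Multiplying by a further letter on the left replaces the left vector by that of the new
  letter; the right vector \<open>r\<close> is only rescaled by a nonzero factor.\<close>

lemma word_specialises:
  assumes two: "(2::'k) \<noteq> 0" and letters: "\<And>l. good_letter l (letter_val x y l)"
    and "w \<noteq> []" "reduced_word w"
  shows "\<exists>Y d r. r \<noteq> (0, 0) \<and> specialises (word_val x y w) Y d \<and> eval1_m2 Y = outer (lvec (hd w)) r"
  using assms(3-)
proof (induction w)
  case (Cons l w)
  obtain L d \<kappa> where L: "\<kappa> \<noteq> 0" "specialises (letter_val x y l) L d"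
      "eval1_m2 L = scalar2 \<kappa> * outer (lvec l) (lvec l)"
    using letters[of l] unfolding good_letter_def by blast
  show ?case
  proof (cases w)
    case Nil
    have "(\<kappa> * fst (lvec l), \<kappa> * snd (lvec l)) \<noteq> (0, 0)"
      using L(1) by (cases l rule: lvec.cases) auto
    moreover have "eval1_m2 L = outer (lvec l) (\<kappa> * fst (lvec l), \<kappa> * snd (lvec l))"
      unfolding L(3) by (simp add: outer_def scalar2_def m2_ops algebra_simps)
    moreover have "specialises (word_val x y (l # w)) L d"
      using L(2) by (simp add: Nil word_val_def)
    ultimately show ?thesis
      unfolding list.sel by blast
  next
    case Cons': (Cons l' w')
    from Cons.prems(2) have red: "reduced_word w" "\<not> (fst l = fst l' \<and> snd l \<noteq> snd l')"
      using reduced_word_Cons unfolding Cons' by blast+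
    obtain Y e r where Y: "r \<noteq> (0, 0)" "specialises (word_val x y w) Y e" "eval1_m2 Y = outer (lvec l') r"
      using Cons.IH red(1) unfolding Cons' by auto
    obtain r' where r': "r' \<noteq> (0, 0)"
        "scalar2 \<kappa> * outer (lvec l) (lvec l) * outer (lvec l') r = outer (lvec l) r'"
      using lvec_product_nonzero[OF two L(1) Y(1) red(2)] by blast
    have "specialises (word_val x y (l # w)) (L * Y) (d * e)"
      using specialises_mult[OF L(2) Y(2)] by (simp add: word_val_def)
    moreover have "eval1_m2 (L * Y) = outer (lvec l) r'"
      by (simp add: eval1_m2_mult L(3) Y(3) r'(2))
    ultimately show ?thesis
      unfolding list.sel using r'(1) by blast
  qed
qed simp

lemma good_letter_nonzero:
  assumes "good_letter l z"
  shows "z \<noteq> 0"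
proof
  assume "z = 0"
  then obtain Y d \<kappa> where 1: "\<kappa> \<noteq> 0" "specialises 0 Y d" "eval1_m2 Y = scalar2 \<kappa> * outer (lvec l) (lvec l)"
    using assms unfolding good_letter_def by blast
  then obtain p P s e where 2: "spec_rel gens p P" "denom s e" "0 = p * inverse s"
      "P * scalar2 d = Y * scalar2 e"
    unfolding specialises_def by blast
  then have "p = 0"
    using denom_nonzero by auto
  then have "P = 0"
    using 2(1) rel_functional by simp
  then have "scalar2 e * Y = scalar2 e * 0"
    using 2(4) by (simp add: scalar2_commute)
  then have "Y = 0"
    using scalar2_mult_left_cancel denom_rel[OF 2(2)] by blast
  then show False
    using 1 by (cases l rule: lvec.cases) (auto simp: eval1_m2_def outer_def scalar2_def m2_ops)
qed

theorem good_free_pair: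
  assumes two: "(2::'k) \<noteq> 0" and "good True x" "good False y"
  shows "free_pair x y"
proof -
  have letters: "good_letter l (letter_val x y l)" for l
    using assms(2,3) unfolding good_def by (cases l rule: lvec.cases) (auto simp: letter_val_def)
  have "word_val x y w \<noteq> 1" if w: "w \<noteq> []" "reduced_word w" for w
  proof
    assume 1: "word_val x y w = 1"
    obtain Y d r where Y: "r \<noteq> (0, 0)" "specialises (word_val x y w) Y d" "eval1_m2 Y = outer (lvec (hd w)) r"
      using word_specialises[OF two letters w] by blast
    \<comment> \<open>A trivial word would have a scalar numerator, and a scalar it stays at X = 1,
      against rank one.\<close>
    then have "Y = scalar2 d"
      using specialises_one_scalar 1 by simp
    then show False
      using outer_lvec_not_scalar[OF Y(1)] Y(3) eval1_m2_scalar2 by metis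
  qed
  moreover have "x \<noteq> 0" "y \<noteq> 0"
    using assms(2,3) good_letter_nonzero unfolding good_def by blast+
  ultimately show ?thesis
    unfolding free_pair_def by blast
qed

section \<open>Rational functions of A and B with rank one specialisations\<close>

definition var :: "bool \<Rightarrow> 'd" where "var b = (if b then A else B)"
definition mvar :: "bool \<Rightarrow> 'k poly m2" where "mvar b = (if b then mat_A else mat_B)"
definition gens_var :: "bool \<Rightarrow> ('d \<times> 'k poly m2) set" where
  "gens_var b = (if b then gensA else gensB)"

lemma rel_var: "spec_rel (gens_var b) (var b) (mvar b)"
  by (rule rel_gen) (simp add: gens_var_def var_def mvar_def gensA_def gensB_def)

lemma gens_var_subset: "gensC \<subseteq> gens_var b" "gens_var b \<subseteq> gens"
  using gensC_subset by (auto simp: gens_var_def)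

lemma denom_var: "spec_rel (gens_var b) s (scalar2 e) \<Longrightarrow> e \<noteq> 0 \<Longrightarrow> denom s e"
  by (auto simp: gens_var_def denomA denomB split: if_splits)

text \<open>Rationalising the denominator: \<open>m'\<close> acts as a conjugate of
  \<open>m\<close>, and \<open>m * m'\<close> is an admissible denominator because its image is
  scalar.\<close>

lemma specialises_conjugate_denominator:
  assumes "spec_rel (gens_var b) n N" "spec_rel (gens_var b) m M" "spec_rel (gens_var b) m' M'"
    "M * M' = scalar2 e" "e \<noteq> 0"
  shows "specialises (n * inverse m) (N * M') e"
proof -
  have d: "denom (m * m') e"
    using rel_mult[OF assms(2,3)] assms(4,5) by (simp add: denom_var)
  have "spec_rel gens (n * m') (N * M')"
    using rel_mult[OF assms(1,3)] rel_mono gens_var_subset(2) by blast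
  from specialises_quotient[OF this d] have "specialises (n * m' * inverse (m * m')) (N * M') e" .
  moreover have "m \<noteq> 0" "m' \<noteq> 0"
    using denom_nonzero[OF d] by auto
  then have "n * m' * inverse (m * m') = n * inverse m"
    by (simp add: nonzero_inverse_mult_distrib mult.assoc) (simp add: mult.assoc[symmetric])
  ultimately show ?thesis by simp
qed

text \<open>The conjugates \<open>n'\<close> and \<open>m'\<close> give numerator and denominator
  nonzero scalar norms, so the element and its inverse both specialise.\<close>

lemma goodI:
  assumes n: "spec_rel (gens_var b) n N" "spec_rel (gens_var b) n' N'"
    and m: "spec_rel (gens_var b) m M" "spec_rel (gens_var b) m' M'"
    and "N * N' = scalar2 e" "e \<noteq> 0" "M * M' = scalar2 f" "f \<noteq> 0"
    and "eval1_m2 (N * M') = scalar2 \<kappa> * outer (lvec (b, True)) (lvec (b, True))" "\<kappa> \<noteq> 0"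
    and "eval1_m2 (M * N') = scalar2 \<kappa>' * outer (lvec (b, False)) (lvec (b, False))" "\<kappa>' \<noteq> 0"
  shows "good b (n * inverse m)"
proof -
  have "specialises (n * inverse m) (N * M') f"
    using assms by (intro specialises_conjugate_denominator)
  moreover have "specialises (m * inverse n) (M * N') e"
    using assms by (intro specialises_conjugate_denominator)
  moreover have "denom (n * n') e" "denom (m * m') f"
    using rel_mult[OF n] rel_mult[OF m] assms by (auto intro: denom_var)
  then have "n \<noteq> 0" "m \<noteq> 0"
    using denom_nonzero by (metis mult_zero_left)+
  then have "inverse (n * inverse m) = m * inverse n"
    by (simp add: nonzero_inverse_mult_distrib)
  ultimately show ?thesis
    unfolding good_def good_letter_def using assms(9-) by auto
qed

lemma rel_one_plus_minus:
  "spec_rel (gens_var b) (1 + var b) (1 + mvar b)" "spec_rel (gens_var b) (1 - var b) (1 - mvar b)"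
  by (intro rel_add rel_diff rel_one rel_var gens_var_subset)+

lemmas mvar_simps = mvar_def mat_A_def mat_B_def scalar2_def outer_def eval1_m2_def m2_ops one_pCons

lemma good_square:
  assumes two: "(2::'k) \<noteq> 0"
  shows "good b ((1 + var b) * (1 + var b))"
proof -
  have four: "(4::'k) \<noteq> 0"
    using two by (metis mult_2 mult_eq_0_iff numeral_Bit0)
  have "good b ((1 + var b) * (1 + var b) * inverse 1)"
    \<comment> \<open>Conjugation negates \<open>var b\<close>. At X = 1 a reflection
      \<open>S\<close> satisfies \<open>(1 + S)^2 = 2 (1 + S)\<close>, and \<open>1 + S\<close> is 2
      or 1 times the outer product, for \<open>A\<close> or \<open>B\<close>; this yields the
      constants 4 and 2.\<close>
    by (rule goodI[where N = "(1 + mvar b) * (1 + mvar b)" and N' = "(1 - mvar b) * (1 - mvar b)"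
          and n' = "(1 - var b) * (1 - var b)" and M = 1 and M' = 1 and m' = 1
          and e = "[:1, 0, -1:] * [:1, 0, -1:]" and f = 1
          and \<kappa> = "if b then 4 else 2" and \<kappa>' = "if b then 4 else 2"];
        (intro rel_mult rel_one_plus_minus rel_one)?)
      (use two four in \<open>auto simp: mvar_simps\<close>)
  then show ?thesis by simp
qed

lemma good_square_div:
  assumes two: "(2::'k) \<noteq> 0"
  shows "good b ((1 + var b) * (1 + var b) * inverse (var b))"
proof -
  have four: "(4::'k) \<noteq> 0"
    using two by (metis mult_2 mult_eq_0_iff numeral_Bit0)
  show ?thesis
    \<comment> \<open>The numerator for the inverse is \<open>S (1 - S)^2 = -2 (1 - S)\<close> at X
      = 1, whence the negative constants.\<close>
    by (rule goodI[where N = "(1 + mvar b) * (1 + mvar b)" and N' = "(1 - mvar b) * (1 - mvar b)"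
          and n' = "(1 - var b) * (1 - var b)" and M = "mvar b" and M' = "mvar b" and m' = "var b"
          and e = "[:1, 0, -1:] * [:1, 0, -1:]" and f = "[:0, 0, 1:]"
          and \<kappa> = "if b then 4 else 2" and \<kappa>' = "if b then -4 else -2"];
        (intro rel_mult rel_one_plus_minus rel_var)?)
      (use two four in \<open>auto simp: mvar_simps\<close>)
qed

lemma good_cayley:
  assumes two: "(2::'k) \<noteq> 0"
  shows "good b ((1 + var b) * inverse (1 - var b))"
proof -
  have four: "(4::'k) \<noteq> 0"
    using two by (metis mult_2 mult_eq_0_iff numeral_Bit0)
  show ?thesis
    by (rule goodI[where N = "1 + mvar b" and N' = "1 - mvar b"
          and n' = "1 - var b" and M = "1 - mvar b" and M' = "1 + mvar b" and m' = "1 + var b"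
          and e = "[:1, 0, -1:]" and f = "[:1, 0, -1:]"
          and \<kappa> = "if b then 4 else 2" and \<kappa>' = "if b then 4 else 2"];
        (intro rel_one_plus_minus)?)
      (use two four in \<open>auto simp: mvar_simps\<close>)
qed

text \<open>Since \<open>\<mu>\<close> vanishes at \<open>q = -1\<close>, the element below has the same specialisation as \<open>1 + var b\<close>.\<close>

lemma good_perturbed:
  assumes two: "(2::'k) \<noteq> 0" and \<mu>: "spec_rel gensC \<mu> 0"
  shows "good b ((1 + var b) * var b * inverse (var b + \<mu>))"
proof -
  have \<mu>': "spec_rel (gens_var b) \<mu> 0"
    using \<mu> gens_var_subset(1) by (rule rel_mono)
  have m: "spec_rel (gens_var b) (var b + \<mu>) (mvar b)" "spec_rel (gens_var b) (var b - \<mu>) (mvar b)"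
    using rel_add[OF rel_var \<mu>'] rel_diff[OF gens_var_subset(1) rel_var \<mu>'] by simp_all
  show ?thesis
    \<comment> \<open>At X = 1 the two numerators are \<open>(1 + S) S S = 1 + S\<close> and
      \<open>S (1 - S) S = 1 - S\<close>; nothing is squared, so the constants are half as
      large.\<close>
    by (rule goodI[where N = "(1 + mvar b) * mvar b" and N' = "(1 - mvar b) * mvar b"
          and n' = "(1 - var b) * var b" and M = "mvar b" and M' = "mvar b" and m' = "var b - \<mu>"
          and e = "[:1, 0, -1:] * [:0, 0, 1:]" and f = "[:0, 0, 1:]"
          and \<kappa> = "if b then 2 else 1" and \<kappa>' = "if b then 2 else 1"];
        (intro rel_mult rel_one_plus_minus rel_var m)?)
      (use two in \<open>auto simp: mvar_simps\<close>)
qed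

end

subsection \<open>Symmetric and unitary pairs from a \<open>q\<close>-commuting pair\<close>

locale div_involution =
  fixes st :: "'d::division_ring \<Rightarrow> 'd"
  assumes st_add: "st (x + y) = st x + st y"
    and st_mult: "st (x * y) = st y * st x"
    and st_st: "st (st x) = x"
begin

lemma st_zero: "st 0 = 0"
  using st_add[of 0 0] by simp

lemma st_one: "st 1 = 1"
  using st_mult[of "st 1" 1] st_st by simp

lemma st_minus: "st (- x) = - st x"
  using st_add[of x "- x"] st_zero by (simp add: minus_unique)

lemma st_diff: "st (x - y) = st x - st y"
  using st_add[of x "- y"] st_minus by simp

lemma st_inverse: "st (inverse x) = inverse (st x)"
proof (cases "x = 0")
  case False
  then have "st x * st (inverse x) = 1"
    using st_mult[of "inverse x" x] st_one by simp
  then show ?thesis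
    by (metis inverse_unique)
qed (simp add: st_zero)

lemma st_eq_0_iff: "st x = 0 \<longleftrightarrow> x = 0"
  using st_st st_zero by metis

text \<open>The conjugate of the quotient is \<open>inverse w * st w\<close>, which is its inverse
  as soon as \<open>w\<close> and \<open>st w\<close> commute.\<close>

lemma unitary_quotient:
  assumes "w \<noteq> 0" "w * st w = st w * w"
  shows "unitary st (w * inverse (st w))"
proof -
  have s: "st w \<noteq> 0"
    using assms(1) st_eq_0_iff by simp
  have c: "inverse (st w) * inverse w = inverse w * inverse (st w)"
    using assms s by (metis nonzero_inverse_mult_distrib)
  have "st (w * inverse (st w)) = inverse w * st w"
    by (simp add: st_mult st_inverse st_st)
  moreover have "w * inverse (st w) * (inverse w * st w) = w * (inverse (st w) * inverse w) * st w"
    by (simp add: mult.assoc)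
  moreover have "\<dots> = 1"
    unfolding c using assms(1) s by (simp add: mult.assoc[symmetric])
  moreover have "inverse w * st w * (w * inverse (st w)) = 1"
  proof -
    have "inverse w * st w * (w * inverse (st w)) = inverse w * (w * st w) * inverse (st w)"
      by (simp only: assms(2) mult.assoc)
    then show ?thesis
      using assms(1) s by (simp add: mult.assoc[symmetric])
  qed
  ultimately show ?thesis
    unfolding unitary_def by simp
qed

lemma symmetric_norm: "st (w * st w) = w * st w"
  by (simp add: st_mult st_st)

end

text \<open>The element \<open>q\<close> is kept, so its transcendence carries over; the new pair
  then has its own specialisation, with \<open>A'\<close> and \<open>B'\<close> sent to
  \<open>mat_A\<close> and \<open>mat_B\<close>.\<close>

lemma q_pair_change:
  assumes "q_pair \<iota> A B q" "A' \<noteq> 0" "B' \<noteq> 0" "A' * B' = q * B' * A'" "q * A' = A' * q" "q * B' = B' * q"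
  shows "q_pair \<iota> A' B' q"
proof -
  interpret q_pair \<iota> A B q by fact
  show ?thesis
    using assms(2-) iota_add iota_mult iota_one iota_central q_nz trans unfolding q_pair_def by blast
qed

locale q_pair_involution = q_pair \<iota> A B q + div_involution st
  for \<iota> :: "'k::field \<Rightarrow> 'd::division_ring" and A B q :: 'd and st :: "'d \<Rightarrow> 'd" +
  assumes two: "(2::'k) \<noteq> 0"
begin

text \<open>According to the action on \<open>var b\<close>, the norm is the square of
  \<open>1 + var b\<close> or that square divided by \<open>var b\<close>.\<close>

lemma good_norm:
  assumes "st (var b) = var b \<or> st (var b) = inverse (var b)"
  shows "good b ((1 + var b) * st (1 + var b))"
  using assms
proof
  assume "st (var b) = var b"
  then show ?thesis
    using good_square[OF two] by (simp add: st_add st_one)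
next
  assume 1: "st (var b) = inverse (var b)"
  have "var b \<noteq> 0"
    using A_nz B_nz by (simp add: var_def)
  then have "1 + inverse (var b) = (1 + var b) * inverse (var b)"
    by (simp add: distrib_right add.commute)
  then show ?thesis
    using good_square_div[OF two] 1 by (simp add: st_add st_one mult.assoc)
qed

lemma good_skew:
  assumes "st (var b) = - var b"
  shows "good b ((1 + var b) * inverse (st (1 + var b)))"
    "(1 + var b) * st (1 + var b) = st (1 + var b) * (1 + var b)"
  using good_cayley[OF two, of b] assms by (simp_all add: st_add st_one algebra_simps)

text \<open>With \<open>v = var b\<close>, the identity \<open>st (1 + v) * v = v + \<mu>\<close>
  turns the unitary quotient into the perturbed fraction treated above.\<close>

lemma good_inverted:
  assumes "st (var b) * var b = \<mu>" "var b * st (var b) = \<mu>" "spec_rel gensC \<mu> 0"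
  shows "good b ((1 + var b) * inverse (st (1 + var b)))"
    "(1 + var b) * st (1 + var b) = st (1 + var b) * (1 + var b)"
proof -
  have v: "var b \<noteq> 0"
    using A_nz B_nz by (simp add: var_def)
  have g: "good b ((1 + var b) * var b * inverse (var b + \<mu>))"
    using good_perturbed[OF two assms(3)] .
  then have w: "1 + var b \<noteq> 0"
    using good_letter_nonzero unfolding good_def by fastforce
  then have s: "st (1 + var b) \<noteq> 0"
    using st_eq_0_iff by blast
  have "var b + \<mu> = st (1 + var b) * var b"
    using assms(1) by (simp add: st_add st_one distrib_right)
  then have "inverse (var b + \<mu>) = inverse (var b) * inverse (st (1 + var b))"
    using v s by (simp add: nonzero_inverse_mult_distrib)
  then have "(1 + var b) * var b * inverse (var b + \<mu>)
      = (1 + var b) * (var b * inverse (var b)) * inverse (st (1 + var b))"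
    by (simp only: mult.assoc)
  then show "good b ((1 + var b) * inverse (st (1 + var b)))"
    using g v by simp
  show "(1 + var b) * st (1 + var b) = st (1 + var b) * (1 + var b)"
    using assms(1,2) by (simp add: st_add st_one algebra_simps)
qed

lemma free_symmetric:
  assumes "st A = A \<or> st A = inverse A" "st B = B \<or> st B = inverse B"
  shows "\<exists>x y. free_symmetric_pair st x y"
proof -
  have "good True ((1 + A) * st (1 + A))" "good False ((1 + B) * st (1 + B))"
    using good_norm[of True] good_norm[of False] assms by (simp_all add: var_def)
  then have "free_pair ((1 + A) * st (1 + A)) ((1 + B) * st (1 + B))"
    by (rule good_free_pair[OF two])
  then show ?thesis
    unfolding free_symmetric_pair_def using symmetric_norm by blast
qed

lemma free_unitary:
  assumes "good True ((1 + A) * inverse (st (1 + A)))" "good False ((1 + B) * inverse (st (1 + B)))"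
    "(1 + A) * st (1 + A) = st (1 + A) * (1 + A)" "(1 + B) * st (1 + B) = st (1 + B) * (1 + B)"
  shows "\<exists>u v. free_unitary_pair st u v"
proof -
  have f: "free_pair ((1 + A) * inverse (st (1 + A))) ((1 + B) * inverse (st (1 + B)))"
    by (rule good_free_pair[OF two assms(1,2)])
  then have "1 + A \<noteq> 0" "1 + B \<noteq> 0"
    unfolding free_pair_def by auto
  then show ?thesis
    unfolding free_unitary_pair_def using f unitary_quotient assms(3,4) by blast
qed

lemma change:
  assumes "A' \<noteq> 0" "B' \<noteq> 0" "A' * B' = q * B' * A'" "q * A' = A' * q" "q * B' = B' * q"
  shows "q_pair_involution \<iota> A' B' q st"
proof -
  interpret q': q_pair \<iota> A' B' q
    using q_pair_change[OF q_pair_axioms assms] .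
  show ?thesis
    by unfold_locales (rule two)
qed

lemma scaled_q_comm:
  assumes "h * A = A * h" "h * B = B * h" "q * h = h * q"
  shows "(h * A) * (h * B) = q * (h * B) * (h * A)"
proof -
  have "(h * A) * (h * B) = h * (A * h) * B"
    by (simp add: mult.assoc)
  also have "\<dots> = h * h * (A * B)"
    by (simp add: assms(1)[symmetric] mult.assoc)
  also have "\<dots> = (h * h * q) * (B * A)"
    by (simp add: q_comm mult.assoc)
  also have "h * h * q = q * h * h"
    by (simp add: assms(3) mult.assoc)
  also have "q * h * h * (B * A) = q * h * (h * B) * A"
    by (simp add: mult.assoc)
  also have "\<dots> = q * h * (B * h) * A"
    by (simp only: assms(2))
  also have "\<dots> = q * (h * B) * (h * A)"
    by (simp only: mult.assoc)
  finally show ?thesis .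
qed

lemma q_sq: "q * q \<noteq> 1"
  using q_power_neq_1[of 2] by (simp add: power2_eq_square)

lemma q_ne_inverse: "q - inverse q \<noteq> 0"
  using q_sq q_inverse by (metis right_minus_eq)

lemma one_plus_q_nz: "1 + q \<noteq> 0"
  using q_sq by (metis add_eq_0_iff2 minus_mult_minus mult_1_left)

lemma BA_nz: "B * A \<noteq> 0"
  using A_nz B_nz by simp

section \<open>The action of the involution on q, and the resulting unitary pairs\<close>

lemma st_q_of_symmetric:
  assumes "st A = A" "st B = B"
  shows "st q = inverse q"
proof -
  have "B * A = st (q * (B * A))"
    using assms st_mult[of A B] q_comm by (simp add: mult.assoc)
  also have "\<dots> = A * B * st q"
    using assms by (simp add: st_mult mult.assoc)
  also have "\<dots> = B * A * (q * st q)"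
    using q_comm q_A q_B by (metis mult.assoc)
  finally have "q * st q = 1"
    using BA_nz by (metis mult_cancel_left mult_1_right)
  then show ?thesis
    by (metis inverse_unique)
qed

lemma st_q_of_inverted:
  assumes "st A = inverse A" "st B = inverse B"
  shows "st q = inverse q"
proof -
  have "inverse (A * B) = st (A * B)"
    using assms A_nz B_nz by (simp add: st_mult nonzero_inverse_mult_distrib)
  also have "\<dots> = st (q * (B * A))"
    by (simp only: q_comm mult.assoc)
  also have "\<dots> = inverse (B * A) * st q"
    using assms A_nz B_nz by (simp add: st_mult nonzero_inverse_mult_distrib)
  also have "inverse (A * B) = inverse (B * A) * inverse q"
    using q_comm q_nz BA_nz by (simp add: mult.assoc nonzero_inverse_mult_distrib)
  finally show ?thesis
    using BA_nz by (metis mult_cancel_left inverse_nonzero_iff_nonzero)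
qed

lemma B_inv_A: "inverse B * A = q * (A * inverse B)"
proof -
  have "inverse B * A = inverse B * (A * B) * inverse B"
    using B_nz by (simp add: mult.assoc)
  also have "\<dots> = inverse B * (B * (q * A)) * inverse B"
    by (metis q_comm q_B mult.assoc)
  also have "\<dots> = q * (A * inverse B)"
    using B_nz by (simp add: mult.assoc[symmetric])
  finally show ?thesis .
qed

lemma q_B_inv: "q * inverse B = inverse B * q"
  using B_nz by (metis q_B mult.assoc left_inverse right_inverse mult_1_left mult_1_right)

lemma st_q_of_mixed:
  assumes "st A = A" "st B = inverse B"
  shows "st q = q"
proof -
  have "inverse B * A = st (q * (B * A))"
    using assms st_mult[of A B] q_comm by (simp add: mult.assoc)
  also have "\<dots> = (A * inverse B) * st q"
    using assms by (simp add: st_mult)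
  finally have "(A * inverse B) * st q = q * (A * inverse B)"
    using B_inv_A by simp
  also have "\<dots> = (A * inverse B) * q"
    using q_A q_B_inv by (metis mult.assoc)
  finally show ?thesis
    using A_nz B_nz by simp
qed

lemma free_unitary_symmetric:
  assumes "st A = A" "st B = B"
  shows "\<exists>u v. free_unitary_pair st u v"
proof -
  \<comment> \<open>As \<open>st q = inverse q\<close>, this factor is skew and commutes with
    \<open>A\<close> and \<open>B\<close>. Scaling by it makes both generators skew, so the Cayley
    transform applies.\<close>
  define h where "h = q - inverse q"
  have h: "h * A = A * h" "h * B = B * h" "q * h = h * q" "h \<noteq> 0"
    using q_A q_B q_inv_A q_inv_B q_ne_inverse q_inverse by (auto simp: h_def algebra_simps)
  have sth: "st h = - h"
    using st_q_of_symmetric[OF assms] by (simp add: h_def st_diff st_inverse)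
  interpret q': q_pair_involution \<iota> "h * A" "h * B" q st
  proof (rule change[OF _ _ scaled_q_comm[OF h(1-3)]])
    show "q * (h * A) = h * A * q" "q * (h * B) = h * B * q"
      by (metis h(3) q_A mult.assoc, metis h(3) q_B mult.assoc)
  qed (use h A_nz B_nz in auto)
  have sk: "st (q'.var b) = - q'.var b" for b
  proof -
    have "st (h * A) = - (h * A)" "st (h * B) = - (h * B)"
      by (simp_all add: st_mult sth assms h(1,2))
    then show ?thesis
      by (simp add: q'.var_def)
  qed
  show ?thesis
    using q'.free_unitary q'.good_skew[OF sk[of True]] q'.good_skew[OF sk[of False]]
    by (simp add: q'.var_def)
qed

lemma relC_one_plus_q: "spec_rel gensC (1 + q) 0" "spec_rel gensC (1 + inverse q) 0"
proof -
  have "spec_rel gensC (1 + q) (1 + - 1)" "spec_rel gensC (1 + inverse q) (1 + - 1)"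
    by (intro rel_add rel_one rel_gen; simp add: gensC_def)+
  then show "spec_rel gensC (1 + q) 0" "spec_rel gensC (1 + inverse q) 0"
    by simp_all
qed

lemma one_plus_q_commute:
  "(1 + q) * A = A * (1 + q)" "(1 + q) * B = B * (1 + q)" "q * (1 + q) = (1 + q) * q"
  using q_A q_B by (simp_all add: algebra_simps)

text \<open>The factor \<open>1 + q\<close> makes the product of \<open>(1 + q) A\<close> with its conjugate vanish at \<open>q = -1\<close>;
  over the field with three elements no constant factor would do.\<close>

lemma free_unitary_inverted:
  assumes "st A = inverse A" "st B = inverse B"
  shows "\<exists>u v. free_unitary_pair st u v"
proof -
  define h where "h = 1 + q"
  define \<mu> where "\<mu> = h * (1 + inverse q)"
  have h: "h * A = A * h" "h * B = B * h" "q * h = h * q" "h \<noteq> 0"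
    using one_plus_q_commute one_plus_q_nz by (simp_all add: h_def)
  have sth: "st h = 1 + inverse q"
    using st_q_of_inverted[OF assms] by (simp add: h_def st_add st_one)
  interpret q': q_pair_involution \<iota> "h * A" "h * B" q st
  proof (rule change[OF _ _ scaled_q_comm[OF h(1-3)]])
    show "q * (h * A) = h * A * q" "q * (h * B) = h * B * q"
      by (metis h(3) q_A mult.assoc, metis h(3) q_B mult.assoc)
  qed (use h A_nz B_nz in auto)
  have c: "h * st h = st h * h"
    unfolding sth by (simp add: h_def algebra_simps q_inverse)
  have stc: "st h * A = A * st h" "st h * B = B * st h"
    unfolding sth using q_inv_A q_inv_B by (simp_all add: algebra_simps)
  have 1: "(h * x) * st (h * x) = \<mu>" "st (h * x) * (h * x) = \<mu>"
    if "x \<noteq> 0" "st x = inverse x" "h * x = x * h" "st h * x = x * st h" for x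
  proof -
    have "(h * x) * st (h * x) = h * (x * inverse x) * st h"
      by (simp only: st_mult that(2) mult.assoc)
    then show "(h * x) * st (h * x) = \<mu>"
      using that(1) by (simp add: \<mu>_def sth)
    have "st (h * x) * (h * x) = inverse x * (st h * h * x)"
      by (simp only: st_mult that(2) mult.assoc)
    also have "st h * h * x = x * (st h * h)"
      by (metis that(3,4) mult.assoc)
    finally show "st (h * x) * (h * x) = \<mu>"
      using that(1) c by (simp add: \<mu>_def sth mult.assoc[symmetric])
  qed
  have "spec_rel q'.gensC \<mu> 0"
    using rel_mult[OF q'.relC_one_plus_q] by (simp add: \<mu>_def h_def)
  moreover have "st (q'.var b) * q'.var b = \<mu>" "q'.var b * st (q'.var b) = \<mu>" for b
    unfolding q'.var_def using 1[OF A_nz assms(1) h(1) stc(1)] 1[OF B_nz assms(2) h(2) stc(2)]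
    by (cases b; simp only: if_True if_False)+
  ultimately have g: "q'.good b ((1 + q'.var b) * inverse (st (1 + q'.var b)))"
    "(1 + q'.var b) * st (1 + q'.var b) = st (1 + q'.var b) * (1 + q'.var b)" for b
    using q'.good_inverted[of b \<mu>] by blast+
  show ?thesis
    using q'.free_unitary g[of True] g[of False] by (simp add: q'.var_def)
qed

lemma free_unitary_mixed:
  assumes "st A = A" "st B = inverse B"
  shows "\<exists>u v. free_unitary_pair st u v"
proof -
  define h where "h = 1 + q"
  define \<mu> where "\<mu> = h * h"
  \<comment> \<open>The subtracted term is \<open>st (A * B)\<close>, so \<open>A'\<close> is skew,
    and both of its terms q-commute with \<open>B\<close>. Since \<open>st q = q\<close>, the other
    new generator \<open>h * B\<close> has norm \<open>\<mu>\<close>, which vanishes at q =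
    -1.\<close>
  define A' where "A' = A * B - inverse B * A"
  have h: "h * A = A * h" "h * B = B * h" "q * h = h * q" "h \<noteq> 0"
    using one_plus_q_commute one_plus_q_nz by (simp_all add: h_def)
  have sth: "st h = h"
    using st_q_of_mixed[OF assms] by (simp add: h_def st_add st_one)
  have qA': "q * A' = A' * q"
    unfolding A'_def right_diff_distrib left_diff_distrib
    by (metis q_A q_B q_B_inv mult.assoc)
  have A'B: "A' * B = q * B * A'"
  proof -
    have "inverse B * A * B = inverse B * B * (q * A)"
      by (metis q_comm q_B mult.assoc)
    also have "\<dots> = q * (B * inverse B) * A"
      using B_nz by simp
    finally have "inverse B * A * B = q * B * (inverse B * A)"
      by (simp add: mult.assoc)
    moreover have "A * B * B = q * B * (A * B)"
      using q_comm by (simp add: mult.assoc)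
    ultimately show ?thesis
      unfolding A'_def by (simp add: left_diff_distrib right_diff_distrib)
  qed
  have A'_nz: "A' \<noteq> 0"
  proof
    assume "A' = 0"
    \<comment> \<open>Otherwise \<open>inverse B\<close> would be \<open>q * B\<close>, and moving
      \<open>A\<close> across it would give \<open>q * q = 1\<close>.\<close>
    then have "q * B * A = inverse B * A"
      unfolding A'_def using q_comm by simp
    then have "q * B = inverse B"
      using A_nz by simp
    then have "A * B = q * (A * (q * B))"
      using B_inv_A q_comm by simp
    also have "\<dots> = q * (A * q) * B"
      by (simp only: mult.assoc)
    also have "\<dots> = (q * q) * (A * B)"
      by (simp only: q_A[symmetric] mult.assoc)
    finally show False
      using q_sq A_nz B_nz by simp
  qed
  have stA': "st A' = - A'"
    by (simp add: A'_def st_diff st_mult st_inverse assms)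
  interpret q': q_pair_involution \<iota> A' "h * B" q st
  proof (rule change[OF A'_nz])
    show "h * B \<noteq> 0"
      using h B_nz by simp
    have hA': "h * A' = A' * h"
      using qA' by (simp add: h_def algebra_simps)
    have "A' * (h * B) = h * (A' * B)"
      by (metis hA' mult.assoc)
    also have "\<dots> = q * (h * B) * A'"
      unfolding A'B by (metis h(3) mult.assoc)
    finally show "A' * (h * B) = q * (h * B) * A'" .
    show "q * (h * B) = h * B * q"
      by (metis h(3) q_B mult.assoc)
  qed (rule qA')
  have "spec_rel q'.gensC \<mu> 0"
    using rel_mult[OF q'.relC_one_plus_q(1) q'.relC_one_plus_q(1)] by (simp add: \<mu>_def h_def)
  moreover have "h * B * st (h * B) = \<mu>"
  proof -
    have "h * B * st (h * B) = h * (B * inverse B) * h"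
      by (simp only: st_mult assms sth mult.assoc)
    then show ?thesis
      using B_nz by (simp add: \<mu>_def)
  qed
  moreover have "st (h * B) * (h * B) = \<mu>"
  proof -
    have "st (h * B) * (h * B) = inverse B * (h * (h * B))"
      by (simp only: st_mult assms sth mult.assoc)
    also have "h * (h * B) = B * (h * h)"
      by (metis h(2) mult.assoc)
    finally show ?thesis
      using B_nz by (simp add: \<mu>_def mult.assoc[symmetric])
  qed
  ultimately show ?thesis
    using q'.free_unitary q'.good_skew[of True] q'.good_inverted[of False \<mu>] stA'
    by (simp add: q'.var_def)
qed

end

subsection \<open>An invariant Heisenberg pair\<close>

text \<open>To be applied to the image of the group in the division ring, with the images of the
  lower central series as \<open>L\<close>, so that the involution acts directly on the elements
  considered.\<close>

locale nilpotent_units = div_involution st for st :: "'d::division_ring \<Rightarrow> 'd" +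
  fixes U :: "'d set" and L :: "nat \<Rightarrow> 'd set" and N :: nat
  assumes U_nz: "x \<in> U \<Longrightarrow> x \<noteq> 0"
    and U_one: "1 \<in> U"
    and U_mult: "x \<in> U \<Longrightarrow> y \<in> U \<Longrightarrow> x * y \<in> U"
    and U_inverse: "x \<in> U \<Longrightarrow> inverse x \<in> U"
    and U_st: "x \<in> U \<Longrightarrow> st x \<in> U"
    and U_sq: "x \<in> U \<Longrightarrow> x * x = 1 \<Longrightarrow> x = 1"
    and U_nonabelian: "\<exists>x\<in>U. \<exists>y\<in>U. x * y \<noteq> y * x"
    and L_0: "L 0 = U"
    and L_subset: "L i \<subseteq> U"
    and L_inverse: "x \<in> L i \<Longrightarrow> inverse x \<in> L i"
    and L_Suc: "x \<in> L i \<Longrightarrow> y \<in> U \<Longrightarrow> x * y * inverse x * inverse y \<in> L (Suc i)"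
    and L_N: "L N = {1}"
begin

section \<open>The automorphism \<tau>, the centre and the second centre\<close>

definition \<tau> :: "'d \<Rightarrow> 'd" where "\<tau> x = inverse (st x)"

definition Z :: "'d set" where "Z = {z \<in> U. \<forall>g\<in>U. z * g = g * z}"

definition Z2 :: "'d set" where "Z2 = {a \<in> U. \<forall>g\<in>U. \<exists>z\<in>Z. a * g = z * g * a}"

lemma tau_U: "x \<in> U \<Longrightarrow> \<tau> x \<in> U"
  by (simp add: \<tau>_def U_inverse U_st)

lemma tau_mult: "x \<in> U \<Longrightarrow> y \<in> U \<Longrightarrow> \<tau> (x * y) = \<tau> x * \<tau> y"
  using U_nz U_st by (simp add: \<tau>_def st_mult nonzero_inverse_mult_distrib)

lemma tau_tau: "\<tau> (\<tau> x) = x"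
  by (simp add: \<tau>_def st_inverse st_st)

lemma tau_inverse: "\<tau> (inverse x) = inverse (\<tau> x)"
  by (simp add: \<tau>_def st_inverse)

lemma U_cancel:
  "x \<in> U \<Longrightarrow> inverse x * (x * y) = y" "x \<in> U \<Longrightarrow> x * (inverse x * y) = y"
  using U_nz[of x] by (simp_all add: mult.assoc[symmetric])

lemma U_inverse_mult: "x \<in> U \<Longrightarrow> y \<in> U \<Longrightarrow> inverse (x * y) = inverse y * inverse x"
  using U_nz by (simp add: nonzero_inverse_mult_distrib)

lemma Z_U: "z \<in> Z \<Longrightarrow> z \<in> U"
  by (simp add: Z_def)

lemma Z_commute: "z \<in> Z \<Longrightarrow> g \<in> U \<Longrightarrow> z * g = g * z"
  by (simp add: Z_def)

lemma ZI: "z \<in> U \<Longrightarrow> (\<And>g. g \<in> U \<Longrightarrow> z * g = g * z) \<Longrightarrow> z \<in> Z"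
  unfolding Z_def by blast

lemma Z_mult:
  assumes "z \<in> Z" "w \<in> Z" shows "z * w \<in> Z"
proof -
  have "z * w * g = g * (z * w)" if "g \<in> U" for g
    by (metis Z_commute[OF assms(1) that] Z_commute[OF assms(2) that] mult.assoc)
  then show ?thesis
    by (rule ZI[OF U_mult[OF Z_U[OF assms(1)] Z_U[OF assms(2)]]])
qed

lemma Z_inverse:
  assumes "z \<in> Z" shows "inverse z \<in> Z"
proof -
  have "inverse z * g = g * inverse z" if "g \<in> U" for g
  proof -
    have "inverse z * (g * z) * inverse z = inverse z * (z * g) * inverse z"
      using Z_commute[OF assms that] by simp
    then show ?thesis
      using U_nz[OF Z_U[OF assms]] U_cancel[OF Z_U[OF assms]] by (simp add: mult.assoc)
  qed
  then show ?thesis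
    by (rule ZI[OF U_inverse[OF Z_U[OF assms]]])
qed

lemma Z_tau:
  assumes "z \<in> Z" shows "\<tau> z \<in> Z"
proof -
  have "\<tau> z * g = g * \<tau> z" if "g \<in> U" for g
    using Z_commute[OF assms tau_U[OF that]] tau_mult Z_U[OF assms] tau_U[OF that] tau_tau by metis
  then show ?thesis
    by (rule ZI[OF tau_U[OF Z_U[OF assms]]])
qed

lemma Z2_U: "a \<in> Z2 \<Longrightarrow> a \<in> U"
  by (simp add: Z2_def)

lemma Z2I: "a \<in> U \<Longrightarrow> (\<And>g. g \<in> U \<Longrightarrow> \<exists>z\<in>Z. a * g = z * g * a) \<Longrightarrow> a \<in> Z2"
  unfolding Z2_def by blast

lemma Z2_E:
  assumes "a \<in> Z2" "g \<in> U" obtains z where "z \<in> Z" "a * g = z * g * a"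
  using assms unfolding Z2_def by blast

lemma Z2_mult:
  assumes "a \<in> Z2" "b \<in> Z2" shows "a * b \<in> Z2"
proof -
  have "\<exists>z\<in>Z. a * b * g = z * g * (a * b)" if g: "g \<in> U" for g
  proof -
    obtain z where z: "z \<in> Z" "a * g = z * g * a" using Z2_E[OF assms(1) g] .
    obtain w where w: "w \<in> Z" "b * g = w * g * b" using Z2_E[OF assms(2) g] .
    have "a * b * g = a * w * g * b"
      by (simp add: w(2) mult.assoc)
    also have "\<dots> = w * (a * g) * b"
      by (simp only: Z_commute[OF w(1) Z2_U[OF assms(1)], symmetric] mult.assoc)
    also have "\<dots> = (w * z) * g * (a * b)"
      by (simp add: z(2) mult.assoc)
    finally show ?thesis
      using Z_mult[OF w(1) z(1)] by blast
  qed
  then show ?thesis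
    by (rule Z2I[OF U_mult[OF Z2_U[OF assms(1)] Z2_U[OF assms(2)]]])
qed

lemma Z2_inverse:
  assumes "a \<in> Z2" shows "inverse a \<in> Z2"
proof -
  have "\<exists>z\<in>Z. inverse a * g = z * g * inverse a" if g: "g \<in> U" for g
  proof -
    have a: "a \<in> U" using assms by (rule Z2_U)
    obtain z where z: "z \<in> Z" "a * g = z * g * a" using Z2_E[OF assms g] .
    have "inverse a * g = inverse z * (inverse a * (z * g * a)) * inverse a"
    proof -
      have "inverse a * (z * g * a) = z * (inverse a * g * a)"
        by (metis Z_commute[OF z(1) U_inverse[OF a]] mult.assoc)
      then have "inverse z * (inverse a * (z * g * a)) * inverse a = inverse z * (z * (inverse a * g * a)) * inverse a"
        by simp
      then show ?thesis
        using U_cancel[OF Z_U[OF z(1)]] U_nz[OF a] by (simp add: mult.assoc)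
    qed
    also have "\<dots> = inverse z * g * inverse a"
      unfolding z(2)[symmetric] using U_cancel[OF a] by (simp add: mult.assoc)
    finally show ?thesis
      using Z_inverse[OF z(1)] by blast
  qed
  then show ?thesis
    by (rule Z2I[OF U_inverse[OF Z2_U[OF assms]]])
qed

lemma Z2_tau:
  assumes "a \<in> Z2" shows "\<tau> a \<in> Z2"
proof -
  have "\<exists>z\<in>Z. \<tau> a * g = z * g * \<tau> a" if g: "g \<in> U" for g
  proof -
    obtain z where z: "z \<in> Z" "a * \<tau> g = z * \<tau> g * a" using Z2_E[OF assms tau_U[OF g]] .
    then have "\<tau> a * \<tau> (\<tau> g) = \<tau> z * \<tau> (\<tau> g) * \<tau> a"
      by (metis tau_mult U_mult tau_U[OF g] Z2_U[OF assms] Z_U)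
    then show ?thesis
      using Z_tau[OF z(1)] tau_tau by auto
  qed
  then show ?thesis
    by (rule Z2I[OF tau_U[OF Z2_U[OF assms]]])
qed

text \<open>The term of the series just before the first central one contains a noncentral element,
  and the commutators of that element with \<open>U\<close> fall into the central term.\<close>

lemma exists_Z2_noncentral: "\<exists>a\<in>Z2. a \<notin> Z"
proof -
  define m where "m = (LEAST m. L m \<subseteq> Z)"
  have "1 \<in> Z"
    by (rule ZI) (simp_all add: U_one)
  then have "L N \<subseteq> Z"
    by (simp add: L_N)
  then have m: "L m \<subseteq> Z"
    unfolding m_def by (rule LeastI)
  moreover have "\<not> L 0 \<subseteq> Z"
    using U_nonabelian unfolding L_0 Z_def by blast
  ultimately obtain m' where m': "m = Suc m'"
    by (cases m) auto
  then have "\<not> L m' \<subseteq> Z"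
    using not_less_Least[of m' "\<lambda>m. L m \<subseteq> Z"] unfolding m_def by simp
  then obtain a where a: "a \<in> L m'" "a \<notin> Z"
    by blast
  have aU: "a \<in> U"
    using a L_subset by blast
  have "\<exists>z\<in>Z. a * g = z * g * a" if g: "g \<in> U" for g
  proof
    show "a * g * inverse a * inverse g \<in> Z"
      using L_Suc[OF a(1) g] m m' by auto
    show "a * g = a * g * inverse a * inverse g * g * a"
      using U_nz aU g by (simp add: mult.assoc U_cancel)
  qed
  then have "a \<in> Z2"
    by (rule Z2I[OF aU])
  then show ?thesis
    using a by blast
qed

text \<open>If \<open>a * b = z * b * a\<close> with \<open>z\<close> central, then passing
  \<open>a\<close> across \<open>b * b * u\<close> costs \<open>z * z\<close>, and
  \<open>z * z = 1\<close> would force \<open>z = 1\<close>.\<close>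

lemma square_noncommuting:
  assumes "a \<in> Z2" "b \<in> U" "u \<in> U" "a * b \<noteq> b * a" "a * u = u * a"
  shows "a * (b * b * u) \<noteq> b * b * u * a"
proof
  assume eq: "a * (b * b * u) = b * b * u * a"
  obtain z where z: "z \<in> Z" "a * b = z * b * a" using Z2_E[OF assms(1,2)] .
  have "a * (b * b * u) = (a * b) * b * u"
    by (simp add: mult.assoc)
  also have "\<dots> = z * b * (a * b) * u"
    by (simp add: z(2) mult.assoc)
  also have "\<dots> = z * (b * z) * b * (a * u)"
    by (simp add: z(2) mult.assoc)
  also have "\<dots> = z * z * (b * b * u * a)"
    by (simp add: Z_commute[OF z(1) assms(2), symmetric] assms(5) mult.assoc)
  finally have "z * z = 1"
    using eq U_nz assms(1-3) Z2_U by simp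
  then have "z = 1"
    using U_sq Z_U z(1) by blast
  then show False
    using z(2) assms(4) by simp
qed

text \<open>The element \<open>u = inverse a * \<tau> a\<close> is inverted by \<open>\<tau>\<close>
  and serves unless it is central. In that case \<open>a * \<tau> a = a * a * u\<close> is fixed by
  \<open>\<tau>\<close>, and it is noncentral because its commutators are the squares of those of
  \<open>a\<close>.\<close>

lemma exists_Z2_eigen: "\<exists>a\<in>Z2. a \<notin> Z \<and> (\<tau> a = a \<or> \<tau> a = inverse a)"
proof -
  obtain a where a: "a \<in> Z2" "a \<notin> Z"
    using exists_Z2_noncentral by blast
  have aU: "a \<in> U" "\<tau> a \<in> U"
    using a Z2_U tau_U by auto
  define u where "u = inverse a * \<tau> a"
  have u: "u \<in> Z2" "u \<in> U" "\<tau> u = inverse u"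
    using aU by (auto simp: u_def Z2_mult Z2_inverse Z2_tau a Z2_U U_mult U_inverse
        tau_mult tau_inverse tau_tau U_inverse_mult)
  show ?thesis
  proof (cases "u \<in> Z")
    case False
    then show ?thesis using u by blast
  next
    case True
    have ta: "\<tau> a = a * u"
      unfolding u_def using U_cancel aU by simp
    have "\<tau> (a * \<tau> a) = a * \<tau> a"
      using aU Z_commute[OF True aU(1)] by (simp add: tau_mult tau_tau) (simp add: ta mult.assoc)
    moreover have "a * \<tau> a \<in> Z2"
      using a by (simp add: Z2_mult Z2_tau)
    moreover have "a * \<tau> a \<notin> Z"
    proof
      assume c: "a * \<tau> a \<in> Z"
      obtain g where g: "g \<in> U" "a * g \<noteq> g * a"
        using a(2) ZI[OF aU(1)] by blast
      obtain z where z: "z \<in> Z" "a * g = z * g * a" using Z2_E[OF a(1) g(1)] .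
      have "a * \<tau> a * g = a * a * (u * g)"
        by (simp add: ta mult.assoc)
      also have "\<dots> = a * (a * g) * u"
        using Z_commute[OF True g(1)] by (simp add: mult.assoc)
      also have "\<dots> = (a * z) * g * (a * u)"
        by (simp add: z(2) mult.assoc)
      also have "\<dots> = z * (a * g) * \<tau> a"
        by (simp add: Z_commute[OF z(1) aU(1), symmetric] ta mult.assoc)
      also have "\<dots> = z * z * (g * (a * \<tau> a))"
        by (simp add: z(2) mult.assoc)
      also have "\<dots> = z * z * (a * \<tau> a * g)"
        using Z_commute[OF c g(1)] by simp
      finally have "z * z = 1"
        using U_nz aU g(1) by simp
      then have "z = 1"
        using U_sq Z_U z(1) by blast
      then show False
        using z(2) g(2) by simp
    qed
    ultimately show ?thesis by blast
  qed
qed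

text \<open>The defect \<open>u = inverse b * \<tau> b\<close> is pushed down the series. If it does
  not commute with \<open>a\<close>, it serves itself, being inverted by \<open>\<tau>\<close>.
  Otherwise \<open>b\<close> is replaced by \<open>b * \<tau> b\<close>, whose defect is a
  commutator of \<open>inverse u\<close> and lies one term lower. In the last term the defect is
  1.\<close>

lemma exists_noncommuting_eigen:
  assumes a: "a \<in> Z2" "a \<notin> Z"
  shows "\<exists>b\<in>U. a * b \<noteq> b * a \<and> (\<tau> b = b \<or> \<tau> b = inverse b)"
proof -
  have "\<exists>b\<in>U. a * b \<noteq> b * a \<and> (\<tau> b = inverse b \<or> inverse b * \<tau> b \<in> L i)" for i
  proof (induction i)
    case 0
    obtain b where "b \<in> U" "a * b \<noteq> b * a"
      using a(2) ZI[OF Z2_U[OF a(1)]] by blast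
    then show ?case
      using L_0 U_mult U_inverse tau_U by blast
  next
    case (Suc i)
    then obtain b where b: "b \<in> U" "a * b \<noteq> b * a" "\<tau> b = inverse b \<or> inverse b * \<tau> b \<in> L i"
      by blast
    define u where "u = inverse b * \<tau> b"
    have bU: "\<tau> b \<in> U"
      using b tau_U by blast
    have u: "u \<in> U" "\<tau> u = inverse u"
      using b(1) bU by (auto simp: u_def U_mult U_inverse tau_mult tau_inverse tau_tau U_inverse_mult)
    show ?case
    proof (cases "\<tau> b = inverse b \<or> a * u \<noteq> u * a")
      case True
      then show ?thesis using b u by blast
    next
      case False
      then have uL: "u \<in> L i" and au: "a * u = u * a"
        using b(3) by (auto simp: u_def)
      have tb: "\<tau> b = b * u"
        unfolding u_def using U_cancel b(1) by simp
      have "\<tau> (b * b * u) = \<tau> (b * \<tau> b)"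
        by (simp add: tb mult.assoc)
      also have "\<dots> = b * u * b"
        by (simp only: tau_mult[OF b(1) bU] tau_tau) (simp only: tb)
      finally have "inverse (b * b * u) * \<tau> (b * b * u) = inverse u * inverse b * inverse (inverse u) * inverse (inverse b)"
        using b(1) u(1) by (simp add: U_inverse_mult U_mult mult.assoc U_cancel)
      then have "inverse (b * b * u) * \<tau> (b * b * u) \<in> L (Suc i)"
        using L_Suc[OF L_inverse[OF uL] U_inverse[OF b(1)]] by simp
      moreover have "a * (b * b * u) \<noteq> b * b * u * a"
        using square_noncommuting[OF a(1) b(1) u(1) b(2) au] .
      ultimately show ?thesis
        using b(1) u(1) U_mult by blast
    qed
  qed
  from this[of N] obtain b where b: "b \<in> U" "a * b \<noteq> b * a" "\<tau> b = inverse b \<or> inverse b * \<tau> b = 1"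
    unfolding L_N by blast
  then have "\<tau> b = b \<or> \<tau> b = inverse b"
    using U_cancel(2)[OF b(1), of "\<tau> b"] by auto
  then show ?thesis
    using b by blast
qed

lemma st_of_tau: "\<tau> x = x \<or> \<tau> x = inverse x \<Longrightarrow> st x = x \<or> st x = inverse x"
  unfolding \<tau>_def by (metis inverse_inverse_eq)

lemma exists_heisenberg_pair:
  "\<exists>a\<in>U. \<exists>b\<in>U. \<exists>q\<in>U. q \<noteq> 1 \<and> a * b = q * b * a \<and> q * a = a * q \<and> q * b = b * q \<and>
     (st a = a \<or> st a = inverse a) \<and> (st b = b \<or> st b = inverse b)"
proof -
  obtain a where a: "a \<in> Z2" "a \<notin> Z" "\<tau> a = a \<or> \<tau> a = inverse a"
    using exists_Z2_eigen by blast
  obtain b where b: "b \<in> U" "a * b \<noteq> b * a" "\<tau> b = b \<or> \<tau> b = inverse b"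
    using exists_noncommuting_eigen[OF a(1,2)] by blast
  obtain q where q: "q \<in> Z" "a * b = q * b * a" using Z2_E[OF a(1) b(1)] .
  have "q \<noteq> 1"
    using q(2) b(2) by auto
  then show ?thesis
    using a(1,3) b(1,3) q Z_U Z_commute Z2_U st_of_tau by blast
qed

end

subsection \<open>Group elements are transcendental\<close>

text \<open>Brings evaluation into the form to which linear independence of group elements
  applies.\<close>

lemma eval_at_sum:
  fixes \<iota> :: "'k::field \<Rightarrow> 'd::division_ring"
  assumes z: "\<iota> 0 = 0" and c: "\<And>a x. \<iota> a * x = x * \<iota> a"
  shows "eval_at \<iota> q f = (\<Sum>l\<le>degree f. \<iota> (coeff f l) * q ^ l)"
proof (induction f)
  case 0
  show ?case by (simp add: eval_at_def z)
next
  case (pCons a p)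
  have "q * (\<iota> x * q ^ l) = \<iota> x * q ^ Suc l" for x l
    by (metis c mult.assoc power_Suc)
  then show ?case
    unfolding eval_at_pCons[of \<iota>, OF z] pCons.IH
    by (cases "p = 0") (simp_all add: z sum_distrib_left sum.atMost_Suc_shift del: power_Suc sum.atMost_Suc)
qed

theorem theorem1p3:
  fixes G :: "('g, 'b) monoid_scheme"
    and \<iota> :: "'k::field \<Rightarrow> 'd::division_ring"
    and \<phi> :: "'g \<Rightarrow> 'd"
    and \<sigma> :: "'g \<Rightarrow> 'g"
    and st :: "'d \<Rightarrow> 'd"
  assumes "CHAR('k) \<noteq> 2"
    and "group G"
    and "nonabelian_group G"
    and "torsion_free_group G"
    and "nilpotent_group G"
    and "is_fraction_division_ring G \<iota> \<phi>"
    and "group_involution G \<sigma>"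
    and "k_involution \<iota> st"
    and "induced_by G \<phi> \<sigma> st"
  shows "(\<exists>x y. free_symmetric_pair st x y) \<and> (\<exists>u v. free_unitary_pair st u v)"
proof -
  interpret group G by fact
  have frac_ring: "\<forall>a b. \<iota> (a + b) = \<iota> a + \<iota> b" "\<forall>a b. \<iota> (a * b) = \<iota> a * \<iota> b"
    "\<iota> 1 = 1" "\<forall>a x. \<iota> a * x = x * \<iota> a"
    "\<forall>x\<in>carrier G. \<forall>y\<in>carrier G. \<phi> (x \<otimes>\<^bsub>G\<^esub> y) = \<phi> x * \<phi> y" "\<phi> \<one>\<^bsub>G\<^esub> = 1"
    "\<forall>S c. finite S \<longrightarrow> S \<subseteq> carrier G \<longrightarrow>
        (\<Sum>g\<in>S. \<iota> (c g) * \<phi> g) = 0 \<longrightarrow> (\<forall>g\<in>S. c g = 0)"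
    using assms(6) unfolding is_fraction_division_ring_def by - (elim conjE, assumption)+
  note iota = frac_ring(1-4)[rule_format] and phi = frac_ring(5,6)[rule_format]
  have indep: "c g = 0" if "finite S" "S \<subseteq> carrier G" "(\<Sum>g\<in>S. \<iota> (c g) * \<phi> g) = 0" "g \<in> S" for S c g
    using frac_ring(7) that by blast
  have iota0: "\<iota> 0 = 0"
    using iota(1)[of 0 0] by simp
  have iotam: "\<iota> (- 1) = - 1"
    using iota(1)[of 1 "-1"] iota(3) iota0 by (simp add: add_eq_0_iff)
  have phi_inv: "\<phi> (inv\<^bsub>G\<^esub> x) = inverse (\<phi> x)" and phi_nz: "\<phi> x \<noteq> 0" if "x \<in> carrier G" for x
  proof -
    have "\<phi> x * \<phi> (inv\<^bsub>G\<^esub> x) = 1"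
      using phi that by (metis inv_closed r_inv)
    then show "\<phi> (inv\<^bsub>G\<^esub> x) = inverse (\<phi> x)" "\<phi> x \<noteq> 0"
      by (auto simp: inverse_unique)
  qed
  have phi_pow: "\<phi> (x [^]\<^bsub>G\<^esub> n) = \<phi> x ^ n" if "x \<in> carrier G" for x and n :: nat
    by (induction n) (simp_all add: that phi power_commutes)
  have phi_inj: "x = y" if "x \<in> carrier G" "y \<in> carrier G" "\<phi> x = \<phi> y" for x y
  proof (rule ccontr)
    assume "x \<noteq> y"
    then have "(\<Sum>g\<in>{x, y}. \<iota> (if g = x then 1 else - 1) * \<phi> g) = 0"
      using that(3) by (simp add: iota iotam)
    from indep[OF _ _ this, of x] show False
      using that by auto
  qed
  have torsion: "x = \<one>\<^bsub>G\<^esub>" if "x \<in> carrier G" "n > 0" "x [^]\<^bsub>G\<^esub> n = \<one>\<^bsub>G\<^esub>" for x and n :: nat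
    using assms(4) that unfolding torsion_free_group_def by blast
  \<comment> \<open>Torsion-freeness makes the powers of \<open>c\<close> distinct, so a polynomial
    relation for \<open>\<phi> c\<close> is a linear relation between group elements; its leading
    coefficient must vanish.\<close>
  have trans: "f = 0" if c: "c \<in> carrier G" "c \<noteq> \<one>\<^bsub>G\<^esub>" and f: "eval_at \<iota> (\<phi> c) f = 0" for c f
  proof (rule ccontr)
    assume "f \<noteq> 0"
    have inj: "inj_on (\<lambda>l::nat. c [^]\<^bsub>G\<^esub> l) {..degree f}"
    proof (rule linorder_inj_onI)
      fix i j :: nat assume "i < j"
      then obtain d where d: "j = i + d" "d > 0"
        using less_imp_add_positive by blast
      have "c [^]\<^bsub>G\<^esub> i \<otimes>\<^bsub>G\<^esub> c [^]\<^bsub>G\<^esub> d \<noteq> c [^]\<^bsub>G\<^esub> i \<otimes>\<^bsub>G\<^esub> \<one>\<^bsub>G\<^esub>"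
        using torsion[OF c(1) d(2)] c by auto
      then show "c [^]\<^bsub>G\<^esub> i \<noteq> c [^]\<^bsub>G\<^esub> j"
        using c(1) by (simp add: d(1) nat_pow_mult[symmetric])
    qed auto
    \<comment> \<open>Recovers the exponent from a power of \<open>c\<close>, to index the
      coefficients by group elements.\<close>
    define k where "k = the_inv_into {..degree f} (\<lambda>l::nat. c [^]\<^bsub>G\<^esub> l)"
    have k: "k (c [^]\<^bsub>G\<^esub> l) = l" if "l \<le> degree f" for l
      unfolding k_def using the_inv_into_f_f[OF inj] that by simp
    let ?S = "(\<lambda>l::nat. c [^]\<^bsub>G\<^esub> l) ` {..degree f}"
    have "(\<Sum>g\<in>?S. \<iota> (coeff f (k g)) * \<phi> g) = (\<Sum>l\<le>degree f. \<iota> (coeff f l) * \<phi> c ^ l)"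
      unfolding sum.reindex[OF inj] by (intro sum.cong) (auto simp: k phi_pow c)
    also have "\<dots> = 0"
      using f eval_at_sum[of \<iota> "\<phi> c" f] iota0 iota(4) by simp
    finally have "coeff f (k (c [^]\<^bsub>G\<^esub> degree f)) = 0"
      using c(1) by (intro indep[of ?S "\<lambda>g. coeff f (k g)"]) auto
    then show False
      using \<open>f \<noteq> 0\<close> by (simp add: k)
  qed
  obtain N where N: "lower_central G N = {\<one>\<^bsub>G\<^esub>}"
    using assms(5) unfolding nilpotent_group_def by blast
  have L: "subgroup (lower_central G i) G" for i
  proof (induction i)
    case 0
    show ?case by (simp add: subgroup_self)
  next
    case (Suc i)
    show ?case
      unfolding lower_central.simps
      by (rule generate_is_subgroup)
        (use subgroup.subset[OF Suc] in \<open>auto simp: commutator_grp_def\<close>)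
  qed
  interpret div_involution st
    using assms(8) unfolding k_involution_def div_involution_def by blast
  have u1: "x \<noteq> 0" if "x \<in> \<phi> ` carrier G" for x
    using that phi_nz by auto
  have u2: "1 \<in> \<phi> ` carrier G"
    using phi(2) by force
  have u3: "x * y \<in> \<phi> ` carrier G" if "x \<in> \<phi> ` carrier G" "y \<in> \<phi> ` carrier G" for x y
    using that by (auto simp: phi(1)[symmetric])
  have u4: "inverse x \<in> \<phi> ` carrier G" if "x \<in> \<phi> ` carrier G" for x
    using that by (auto simp: phi_inv[symmetric])
  have u5: "st x \<in> \<phi> ` carrier G" if "x \<in> \<phi> ` carrier G" for x
    using that assms(7,9) unfolding group_involution_def induced_by_def by auto
  have u6: "x = 1" if "x \<in> \<phi> ` carrier G" "x * x = 1" for x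
  proof -
    from that(1) obtain g where g: "x = \<phi> g" "g \<in> carrier G"
      by (rule imageE)
    have "\<phi> (g [^]\<^bsub>G\<^esub> (2::nat)) = \<phi> \<one>\<^bsub>G\<^esub>"
      unfolding phi_pow[OF g(2)] phi(2) power2_eq_square g(1)[symmetric] by (rule that(2))
    then have "g [^]\<^bsub>G\<^esub> (2::nat) = \<one>\<^bsub>G\<^esub>"
      by (rule phi_inj[OF nat_pow_closed[OF g(2)] one_closed])
    then have "g = \<one>\<^bsub>G\<^esub>"
      by (rule torsion[OF g(2) zero_less_numeral])
    then show ?thesis
      using g(1) phi(2) by simp
  qed
  have u7: "\<exists>x\<in>\<phi> ` carrier G. \<exists>y\<in>\<phi> ` carrier G. x * y \<noteq> y * x"
    using assms(3) phi(1) phi_inj unfolding nonabelian_group_def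
    by (metis image_eqI m_closed)
  have u8: "\<phi> ` lower_central G 0 = \<phi> ` carrier G"
    by simp
  have u9: "\<phi> ` lower_central G i \<subseteq> \<phi> ` carrier G" for i
    using subgroup.subset[OF L] by blast
  have u10: "inverse x \<in> \<phi> ` lower_central G i" if "x \<in> \<phi> ` lower_central G i" for x i
    using that subgroup.m_inv_closed[OF L] subgroup.mem_carrier[OF L]
    by (auto simp: phi_inv[symmetric])
  have u11: "x * y * inverse x * inverse y \<in> \<phi> ` lower_central G (Suc i)"
    if x: "x \<in> \<phi> ` lower_central G i" and y: "y \<in> \<phi> ` carrier G" for x y i
  proof -
    obtain g h where g: "g \<in> lower_central G i" "x = \<phi> g" and h: "h \<in> carrier G" "y = \<phi> h"
      using x y by blast
    have gG: "g \<in> carrier G"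
      using g(1) subgroup.mem_carrier[OF L] by blast
    have "commutator_grp G g h \<in> lower_central G (Suc i)"
      unfolding lower_central.simps using g(1) h(1) by (intro generate.incl) blast
    moreover have "x * y * inverse x * inverse y = \<phi> (commutator_grp G g h)"
      using gG h(1) by (simp add: commutator_grp_def phi phi_inv g(2) h(2))
    ultimately show ?thesis
      by blast
  qed
  have u12: "\<phi> ` lower_central G N = {1}"
    by (simp add: N phi(2))
  interpret nilpotent_units st "\<phi> ` carrier G" "\<lambda>i. \<phi> ` lower_central G i" N
    by (intro nilpotent_units.intro nilpotent_units_axioms.intro div_involution_axioms)
      (fact u1 u2 u3 u4 u5 u6 u7 u8 u9 u10 u11 u12)+
  have two: "(2::'k) \<noteq> 0"
  proof
    assume "(2::'k) = 0"
    then have "of_nat 2 = (0::'k)"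
      by simp
    then have "CHAR('k) dvd 2"
      unfolding of_nat_eq_0_iff_char_dvd .
    then have "CHAR('k) = 1"
      using assms(1) prime_nat_iff two_is_prime_nat by metis
    then show False
      by simp
  qed
  have pair: "q_pair_involution \<iota> a b q st"
    if "a \<in> \<phi> ` carrier G" "b \<in> \<phi> ` carrier G" "q \<in> \<phi> ` carrier G" "q \<noteq> 1"
      "a * b = q * b * a" "q * a = a * q" "q * b = b * q" for a b q
  proof -
    from that(3) obtain c where c: "q = \<phi> c" "c \<in> carrier G"
      by (rule imageE)
    have "c \<noteq> \<one>\<^bsub>G\<^esub>"
      using that(4) c(1) phi(2) by metis
    then have q_trans: "f = 0" if "eval_at \<iota> q f = 0" for f
      using trans[OF c(2)] that unfolding c(1) by metis
    have "q_pair \<iota> a b q"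
      by (rule q_pair.intro[OF iota U_nz[OF that(1)] U_nz[OF that(2)] U_nz[OF that(3)] that(5-7) q_trans])
    then show ?thesis
      using div_involution_axioms two
      by (intro q_pair_involution.intro q_pair_involution_axioms.intro)
  qed
  obtain a b q where ab: "a \<in> \<phi> ` carrier G" "b \<in> \<phi> ` carrier G" "q \<in> \<phi> ` carrier G" "q \<noteq> 1"
      "a * b = q * b * a" "q * a = a * q" "q * b = b * q"
      and sta: "st a = a \<or> st a = inverse a" and stb: "st b = b \<or> st b = inverse b"
    using exists_heisenberg_pair by blast
  interpret P: q_pair_involution \<iota> a b q st
    using pair[OF ab] .
  \<comment> \<open>Exchanging the generators inverts \<open>q\<close>; this covers the case in
    which \<open>a\<close> is inverted and \<open>b\<close> is symmetric.\<close>
  interpret Q: q_pair_involution \<iota> b a "inverse q" st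
  proof (rule pair)
    show "inverse q \<noteq> 1"
      using ab(4) by (metis inverse_1 inverse_inverse_eq)
    show "b * a = inverse q * a * b" "inverse q * b = b * inverse q" "inverse q * a = a * inverse q"
      by (fact P.q_comm' P.q_inv_B P.q_inv_A)+
  qed (fact ab(2) ab(1) U_inverse[OF ab(3)])+
  have "\<exists>u v. free_unitary_pair st u v"
    using sta stb P.free_unitary_symmetric P.free_unitary_inverted P.free_unitary_mixed
      Q.free_unitary_mixed by blast
  then show ?thesis
    using P.free_symmetric[OF sta stb] by blast
qed

end
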